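(* Let $\mathcal S=\{f,\underline p,\bar p\}$ be a convex setup and $\alpha\ge1$. If there exists an $\alpha$-competitive online algorithm, then there must exist $\omega$ with $$F_{\underline p}(\omega)\ge\tfrac1\alpha h(\underline p),\qquad 0\le\omega\le\underline\rho,$$ such that the following hold simultaneously: 1. There exists a case (arrival instance) in which, under the algorithm, the total resource utilization is $\omega$ and all the accepted agents have the same valuation density $\underline p$. 2. There exists a strictly increasing function $\psi$ that satisfies $$\begin{cases}\psi'(p)=\dfrac1\alpha\cdot\dfrac{h'(p)}{p-f'(\psi(p))}, & p\in(\underline p,\bar p),\\[2mm] \psi(\underline p)=\omega,\quad\psi(\bar p)\le\bar\rho.\end{cases}$$ 3. There exists a strictly increasing function $\varphi$ that satisfies $$\begin{cases}\varphi'(y)=\alpha\cdot\dfrac{\varphi(y)-f'(y)}{h'(\varphi(y))}, & y\in(\omega,\bar\rho),\\[2mm]\varphi(\omega)=\underline p,\quad\varphi(\bar\rho)\ge\bar p.\end{cases}$$ 4. $\psi$ and $\varphi$ are inverse to each other, i.e. $\psi=\varphi^{-1}$ (for $p\in[\underline p,\bar p]$, $\varphi(\psi(p))=p$).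
   Context: **Setup.** A setup is $\mathcal S=\{f,\underline p,\bar p\}$ with a cost function $f:[0,1]\to\mathbb R$ and reals $\underline p\le\bar p$. It is *convex* if $f$ is non-decreasing, strictly convex and differentiable, $f(0)=0$ and $f'(0)<\underline p\le\bar p$. Put $\underline c=f'(0)$, $\bar c=f'(1)$; $\bar f=f$ on $[0,1]$ and $\bar f=+\infty$ on $(1,\infty)$; $F_p(y)=py-\bar f(y)$; $h(p)=\max_{y\ge0}F_p(y)$; $\underline\rho=\arg\max_{y\ge0}F_{\underline p}(y)$, $\bar\rho=\arg\max_{y\ge0}F_{\bar p}(y)$. Then $h'(p)=f'^{-1}(p)$ for $p\in[\underline c,\bar c]$ and $h'(p)=1$ for $p>\bar c$. Solutions of boundary value problems are continuous on the closed interval and differentiable on the open interval. **Model.** An arrival instance $\mathcal A=(\theta_1,\dots,\theta_N)$ is a finite sequence of agents with types $\theta_n=(r_n,v_n)$, $r_n>0$ (resource requirement), $v_n$ (valuation), such that the valuation density $v_n/r_n$ satisfies $\underline p\le v_n/r_n\le\bar p$. With $x_n\in\{0,1\}$ indicating whether request $n$ is satisfied (accepted), the social welfare is $\sum_n v_nx_n-f(\sum_n r_nx_n)$ subject to $\sum_n r_nx_n\le1$; $S_{\rm offline}(\mathcal A)$ is its maximum over all feasible $x$. The total resource utilization is $\sum_n r_nx_n$. A (deterministic) online algorithm knows only $\mathcal S$ in advance and chooses $x_n$ irrevocably as a function of $\theta_1,\dots,\theta_n$, keeping feasibility; $S_{\rm online}(\mathcal A)$ is the social welfare it obtains. **Competitiveness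 (infinitesimal requests).** Requests are assumed to be infinitesimal, $r_n\ll1$. Accordingly an online algorithm is $\alpha$-competitive if for every $\delta>0$ there is $\varepsilon>0$ such that $S_{\rm offline}(\mathcal A)\le(\alpha+\delta)S_{\rm online}(\mathcal A)$ for all arrival instances $\mathcal A$ with $\max_n r_n\le\varepsilon$. In the same spirit, item 1 means: for every $\eta>0$ there is an arrival instance with all $r_n\le\eta$ on which all agents accepted by the algorithm have valuation density $\underline p$ and the total utilization is within $\eta$ of $\omega$. *)

theory Defs
  imports "HOL-Analysis.Analysis"
begin

subsection \<open>Setups\<close>

definition strictly_convex_on :: "real set \<Rightarrow> (real \<Rightarrow> real) \<Rightarrow> bool" where
  "strictly_convex_on S f \<longleftrightarrow> convex S \<and>
     (\<forall>x\<in>S. \<forall>y\<in>S. \<forall>t. x \<noteq> y \<and> 0 < t \<and> t < 1 \<longrightarrow>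
        f ((1 - t) * x + t * y) < (1 - t) * f x + t * f y)"

text \<open>A cost function is a total function on the reals of which only the values on
  \<open>{0..1}\<close> are ever used. Its derivative is taken within \<open>{0..1}\<close>, so it is
  one-sided at the two endpoints.\<close>

definition marginal_cost :: "(real \<Rightarrow> real) \<Rightarrow> real \<Rightarrow> real" where
  "marginal_cost f y = vector_derivative f (at y within {0..1})"

definition convex_setup :: "(real \<Rightarrow> real) \<Rightarrow> real \<Rightarrow> real \<Rightarrow> bool" where
  "convex_setup f p_lo p_hi \<longleftrightarrow>
     mono_on {0..1} f \<and> strictly_convex_on {0..1} f \<and> f differentiable_on {0..1} \<and>
     f 0 = 0 \<and> marginal_cost f 0 < p_lo \<and> p_lo \<le> p_hi"

text \<open>The extended cost is only meant for arguments \<open>y \<ge> 0\<close>.\<close>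

definition ext_cost :: "(real \<Rightarrow> real) \<Rightarrow> real \<Rightarrow> ereal" where
  "ext_cost f y = (if y \<le> 1 then ereal (f y) else \<infinity>)"

definition profit :: "(real \<Rightarrow> real) \<Rightarrow> real \<Rightarrow> real \<Rightarrow> ereal" where
  "profit f p y = ereal (p * y) - ext_cost f y"

text \<open>For a convex setup the supremum below is finite and attained at exactly one point, so
  it is a maximum and the choice made by \<open>arg_max\<close> is the only possible one.\<close>

definition max_profit :: "(real \<Rightarrow> real) \<Rightarrow> real \<Rightarrow> real" where
  "max_profit f p = real_of_ereal (SUP y\<in>{0..}. profit f p y)"

definition opt_load :: "(real \<Rightarrow> real) \<Rightarrow> real \<Rightarrow> real" where
  "opt_load f p = (ARG_MAX (profit f p) y. 0 \<le> y)"

subsection \<open>Arrival instances and social welfare\<close>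

text \<open>An agent is a pair of resource requirement and valuation.\<close>

type_synonym agent = "real \<times> real"

definition density :: "agent \<Rightarrow> real" where
  "density a = snd a / fst a"

definition arrival_instance :: "real \<Rightarrow> real \<Rightarrow> agent list \<Rightarrow> bool" where
  "arrival_instance p_lo p_hi as \<longleftrightarrow>
     (\<forall>a\<in>set as. 0 < fst a \<and> p_lo \<le> density a \<and> density a \<le> p_hi)"

text \<open>The 0/1 vector of decisions is represented by the set of indices of accepted agents.\<close>

definition utilization :: "agent list \<Rightarrow> nat set \<Rightarrow> real" where
  "utilization as X = (\<Sum>n\<in>X. fst (as ! n))"

definition welfare :: "(real \<Rightarrow> real) \<Rightarrow> agent list \<Rightarrow> nat set \<Rightarrow> real" where
  "welfare f as X = (\<Sum>n\<in>X. snd (as ! n)) - f (utilization as X)"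

definition S_offline :: "(real \<Rightarrow> real) \<Rightarrow> agent list \<Rightarrow> real" where
  "S_offline f as = Max (welfare f as ` {X. X \<subseteq> {..<length as} \<and> utilization as X \<le> 1})"

subsection \<open>Online algorithms\<close>

text \<open>A deterministic algorithm maps the nonempty list of agents seen so far to its decision on
  the last agent of that list.\<close>

type_synonym algorithm = "agent list \<Rightarrow> bool"

definition accepted :: "algorithm \<Rightarrow> agent list \<Rightarrow> nat set" where
  "accepted A as = {n. n < length as \<and> A (take (Suc n) as)}"

definition online_algorithm :: "real \<Rightarrow> real \<Rightarrow> algorithm \<Rightarrow> bool" where
  "online_algorithm p_lo p_hi A \<longleftrightarrow>
     (\<forall>as. arrival_instance p_lo p_hi as \<longrightarrow> utilization as (accepted A as) \<le> 1)"

definition S_online :: "(real \<Rightarrow> real) \<Rightarrow> algorithm \<Rightarrow> agent list \<Rightarrow> real" where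
  "S_online f A as = welfare f as (accepted A as)"

definition competitive ::
  "(real \<Rightarrow> real) \<Rightarrow> real \<Rightarrow> real \<Rightarrow> real \<Rightarrow> algorithm \<Rightarrow> bool" where
  "competitive f p_lo p_hi \<alpha> A \<longleftrightarrow>
     (\<forall>\<delta>>0. \<exists>\<epsilon>>0. \<forall>as. arrival_instance p_lo p_hi as \<and> (\<forall>a\<in>set as. fst a \<le> \<epsilon>) \<longrightarrow>
        S_offline f as \<le> (\<alpha> + \<delta>) * S_online f A as)"

text \<open>In the infinitesimal regime, the utilization \<open>w\<close> is reached by accepting only
  agents of density \<open>p\<close>.\<close>

definition reaches_utilization ::
  "real \<Rightarrow> real \<Rightarrow> algorithm \<Rightarrow> real \<Rightarrow> real \<Rightarrow> bool" where
  "reaches_utilization p_lo p_hi A p w \<longleftrightarrow>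
     (\<forall>\<eta>>0. \<exists>as. arrival_instance p_lo p_hi as \<and> (\<forall>a\<in>set as. fst a \<le> \<eta>) \<and>
        (\<forall>n\<in>accepted A as. density (as ! n) = p) \<and>
        \<bar>utilization as (accepted A as) - w\<bar> \<le> \<eta>)"

subsection \<open>The boundary value problems\<close>

text \<open>Since \<open>x / 0 = 0\<close>, both problems require explicitly that the denominator on the
  right-hand side does not vanish.\<close>

definition solves_\<psi>_bvp ::
  "(real \<Rightarrow> real) \<Rightarrow> real \<Rightarrow> real \<Rightarrow> real \<Rightarrow> real \<Rightarrow> (real \<Rightarrow> real) \<Rightarrow> bool" where
  "solves_\<psi>_bvp f p_lo p_hi \<alpha> w \<psi> \<longleftrightarrow>
     continuous_on {p_lo..p_hi} \<psi> \<and>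
     (\<forall>p\<in>{p_lo<..<p_hi}.
        p - marginal_cost f (\<psi> p) \<noteq> 0 \<and>
        (\<psi> has_real_derivative
           1 / \<alpha> * (deriv (max_profit f) p / (p - marginal_cost f (\<psi> p)))) (at p)) \<and>
     \<psi> p_lo = w \<and> \<psi> p_hi \<le> opt_load f p_hi"

definition solves_\<phi>_bvp ::
  "(real \<Rightarrow> real) \<Rightarrow> real \<Rightarrow> real \<Rightarrow> real \<Rightarrow> real \<Rightarrow> (real \<Rightarrow> real) \<Rightarrow> bool" where
  "solves_\<phi>_bvp f p_lo p_hi \<alpha> w \<phi> \<longleftrightarrow>
     continuous_on {w..opt_load f p_hi} \<phi> \<and>
     (\<forall>y\<in>{w<..<opt_load f p_hi}.
        deriv (max_profit f) (\<phi> y) \<noteq> 0 \<and>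
        (\<phi> has_real_derivative
           \<alpha> * ((\<phi> y - marginal_cost f y) / deriv (max_profit f) (\<phi> y))) (at y)) \<and>
     \<phi> w = p_lo \<and> \<phi> (opt_load f p_hi) \<ge> p_hi"

end

theory Submission
  imports Defs
begin

text \<open>
  Feed the algorithm with many small agents of slowly rising density. If its utilization is
  \<open>u\<close> once all densities up to \<open>p\<close> have been offered, then its welfare must be at least
  \<open>h p / \<alpha>\<close>; compared with the extremal case of equality, this says that the welfare grows no
  faster than a solution of \<open>\<phi>' = \<alpha> (\<phi> - f') / h'(\<phi>)\<close>. The right-hand side need not be Lipschitz
  in \<open>\<phi>\<close>, but in the variable \<open>W = h \<circ> \<phi>\<close> the equation becomes
  \<open>W' = \<alpha> (h\<^sup>-\<^sup>1(W) - f')\<close>, and \<open>h\<^sup>-\<^sup>1\<close> is Lipschitz above \<open>p_lo\<close> because \<open>h'\<close> is bounded below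
  there. Replacing the right-hand side by its positive part gives a global solution with
  \<open>W 0 = 0\<close>, and a discrete Gronwall estimate shows \<open>h p_hi \<le> W 1\<close>. This forces the positive part
  to be inessential up to the optimal load of \<open>p_hi\<close>. Then \<open>\<omega>\<close> is the point where \<open>W\<close> reaches
  \<open>h p_lo\<close>, \<open>\<phi> = h\<^sup>-\<^sup>1 \<circ> W\<close>, and \<open>\<psi>\<close> is the inverse of \<open>\<phi>\<close>.
\<close>

subsection \<open>A global Picard--Lindeloef theorem\<close>

text \<open>Banach's fixed point theorem is applied to the integral equation in the weighted unknown
  \<open>exp (- (2 * L * t)) * W t\<close>. With this weight the operator contracts by 1/2 on the
  whole interval, whatever its length, so no local solutions have to be glued together.\<close>

lemma picard_lindelof_interval:
  fixes G :: "real \<Rightarrow> real \<Rightarrow> real"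
  assumes ab: "a \<le> b" and L: "0 < L"
    and cont: "continuous_on ({a..b} \<times> UNIV) (\<lambda>(t, x). G t x)"
    and lip: "\<And>t x y. t \<in> {a..b} \<Longrightarrow> \<bar>G t x - G t y\<bar> \<le> L * \<bar>x - y\<bar>"
  obtains W where "W a = w0"
    and "\<And>t. t \<in> {a..b} \<Longrightarrow> (W has_real_derivative G t (W t)) (at t within {a..b})"
proof -
  define R where "R V s = G s (exp (2 * L * s) * V s)" for V :: "real \<Rightarrow> real" and s
  define P where "P V t = exp (- (2 * L * t)) * (w0 + integral {a..t} (R V))" for V t
  \<comment> \<open>Clamping the argument to \<open>{a..b}\<close> extends a function on the
    interval to a bounded continuous function on the line, so that the fixed point can be sought in
    the complete space of such functions.\<close>
  define T where "T V = Bcontfun (\<lambda>t. P (apply_bcontfun V) (max a (min b t)))" for V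
  have contR: "continuous_on {a..b} (R V)" if "continuous_on {a..b} V" for V
  proof -
    have "continuous_on {a..b} (\<lambda>s. (\<lambda>(t, x). G t x) (s, exp (2 * L * s) * V s))"
      by (rule continuous_on_compose2[OF cont]) (auto intro!: continuous_intros that)
    then show ?thesis by (simp add: R_def[abs_def])
  qed
  have contP: "continuous_on {a..b} (P V)" if "continuous_on {a..b} V" for V
  proof -
    have "continuous_on {a..b} (\<lambda>t. integral {a..t} (R V))"
      by (intro indefinite_integral_continuous_1 integrable_continuous_interval contR that)
    then show ?thesis unfolding P_def[abs_def] by (intro continuous_intros)
  qed
  have T: "apply_bcontfun (T V) t = P (apply_bcontfun V) (max a (min b t))" for V t
  proof -
    have c: "continuous_on {a..b} (P (apply_bcontfun V))"
      by (rule contP) simp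
    have "continuous_on UNIV (\<lambda>t. P (apply_bcontfun V) (max a (min b t)))"
      by (rule continuous_on_compose2[OF c]) (use ab in \<open>auto intro!: continuous_intros\<close>)
    moreover have "bounded (range (\<lambda>t. P (apply_bcontfun V) (max a (min b t))))"
      by (rule bounded_subset[OF compact_imp_bounded[OF compact_continuous_image[OF c]]])
        (use ab in auto)
    ultimately show ?thesis
      unfolding T_def by (subst Bcontfun_inverse) (auto simp: bcontfun_def)
  qed
  have "dist (T V) (T U) \<le> 1 / 2 * dist V U" for V U
  proof (rule dist_bound)
    fix t'
    define t where "t = max a (min b t')"
    define d where "d = dist V U"
    have t: "a \<le> t" "t \<le> b" using ab by (auto simp: t_def)
    have int: "R (apply_bcontfun X) integrable_on {a..t}" for X
      by (rule integrable_continuous_interval, rule continuous_on_subset[of "{a..b}"])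
        (use t in \<open>auto intro!: contR\<close>)
    \<comment> \<open>Integrating \<open>L\<close> times the weight is the source of the factor 1/2;
      the outer weight in \<open>P\<close> later cancels \<open>exp (2 * L * t)\<close>.\<close>
    have *: "((\<lambda>s. L * exp (2 * L * s) * d) has_integral
        exp (2 * L * t) * d / 2 - exp (2 * L * a) * d / 2) {a..t}"
      by (rule fundamental_theorem_of_calculus)
        (use t in \<open>auto intro!: derivative_eq_intros
          simp: has_real_derivative_iff_has_vector_derivative[symmetric]\<close>)
    have "norm (R V s - R U s) \<le> L * exp (2 * L * s) * d" if "s \<in> {a..t}" for s
    proof -
      have "\<bar>R V s - R U s\<bar> \<le> L * \<bar>exp (2 * L * s) * V s - exp (2 * L * s) * U s\<bar>"
        unfolding R_def by (rule lip) (use that t in auto)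
      also have "\<dots> = L * exp (2 * L * s) * \<bar>V s - U s\<bar>"
        using L by (simp add: abs_mult right_diff_distrib[symmetric])
      also have "\<bar>V s - U s\<bar> \<le> d"
        using dist_bounded[of V s U] by (simp add: d_def dist_real_def)
      finally show ?thesis using L by (simp add: mult_left_mono)
    qed
    then have "norm (integral {a..t} (\<lambda>s. R V s - R U s)) \<le> integral {a..t} (\<lambda>s. L * exp (2 * L * s) * d)"
      by (intro integral_norm_bound_integral integrable_diff int) (use * in auto)
    also have "\<dots> \<le> exp (2 * L * t) * d / 2"
      using integral_unique[OF *] by (simp add: d_def)
    finally have "\<bar>integral {a..t} (R V) - integral {a..t} (R U)\<bar> \<le> exp (2 * L * t) * d / 2"
      using integral_diff[OF int[of V] int[of U]] by simp
    then have "exp (- (2 * L * t)) * \<bar>integral {a..t} (R V) - integral {a..t} (R U)\<bar>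
        \<le> exp (- (2 * L * t)) * (exp (2 * L * t) * d / 2)"
      by (rule mult_left_mono) simp
    also have "\<dots> = d / 2" by (simp add: exp_minus)
    also have "exp (- (2 * L * t)) * \<bar>integral {a..t} (R V) - integral {a..t} (R U)\<bar>
        = \<bar>P V t - P U t\<bar>"
      by (simp add: P_def right_diff_distrib[symmetric] abs_mult)
    finally show "dist (T V t') (T U t') \<le> 1 / 2 * dist V U"
      by (simp add: T t_def[symmetric] dist_real_def d_def)
  qed
  then obtain V where V: "T V = V"
    using banach_fix_type[of "1 / 2" T] by auto
  \<comment> \<open>The weight is undone here. On the interval this integral equals
    \<open>exp (2 * L * t) * V t\<close>, so \<open>R V\<close> is \<open>G\<close> evaluated along
    \<open>W\<close>.\<close>
  define W where "W t = w0 + integral {a..t} (R V)" for t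
  have W: "W t = exp (2 * L * t) * V t" if "t \<in> {a..b}" for t
  proof -
    have "max a (min b t) = t" using that by auto
    then have "V t = P V t" using T[of V t] V by simp
    then show ?thesis by (simp add: P_def W_def exp_minus field_simps)
  qed
  have "(W has_real_derivative G t (W t)) (at t within {a..b})" if "t \<in> {a..b}" for t
  proof -
    have "(W has_real_derivative R V t) (at t within {a..b})"
      unfolding W_def[abs_def]
      by (rule derivative_eq_intros integral_has_real_derivative contR that refl | simp)+
    then show ?thesis using W[OF that] by (simp add: R_def)
  qed
  moreover have "W a = w0" by (simp add: W_def)
  ultimately show thesis using that by blast
qed

subsection \<open>Convex costs\<close>

locale convex_cost =
  fixes f :: "real \<Rightarrow> real"
  assumes f_mono_on: "mono_on {0..1} f"
    and f_strictly_convex: "strictly_convex_on {0..1} f"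
    and f_differentiable: "f differentiable_on {0..1}"
    and f_zero: "f 0 = 0"
begin

abbreviation c :: "real \<Rightarrow> real" where "c \<equiv> marginal_cost f"
abbreviation h :: "real \<Rightarrow> real" where "h \<equiv> max_profit f"
abbreviation \<rho> :: "real \<Rightarrow> real" where "\<rho> \<equiv> opt_load f"

lemma f_mono: "0 \<le> x \<Longrightarrow> x \<le> y \<Longrightarrow> y \<le> 1 \<Longrightarrow> f x \<le> f y"
  using f_mono_on by (auto simp: mono_on_def)

lemma f_nonneg: "0 \<le> x \<Longrightarrow> x \<le> 1 \<Longrightarrow> 0 \<le> f x"
  using f_mono[of 0 x] f_zero by simp

lemma f_deriv:
  assumes "x \<in> {0..1}"
  shows "(f has_real_derivative c x) (at x within {0..1})"
  using assms f_differentiable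
  by (auto simp: marginal_cost_def differentiable_on_def vector_derivative_works
      has_real_derivative_iff_has_vector_derivative)

lemma f_continuous: "continuous_on {0..1} f"
  using f_deriv DERIV_continuous by (fastforce simp: continuous_on_eq_continuous_within)

section \<open>Secant slopes and the marginal cost\<close>

lemma slopes:
  assumes "0 \<le> x" "x < z" "z < y" "y \<le> 1"
  shows "(f z - f x) / (z - x) < (f y - f x) / (y - x)"
    and "(f y - f x) / (y - x) < (f y - f z) / (y - z)"
proof -
  define t where "t = (z - x) / (y - x)"
  have t: "0 < t" "t < 1" using assms by (auto simp: t_def)
  have "t * (y - x) = z - x" using assms by (simp add: t_def)
  then have z: "z = (1 - t) * x + t * y" by (simp add: algebra_simps)
  have "f z < (1 - t) * f x + t * f y"
    unfolding z using f_strictly_convex t assms unfolding strictly_convex_on_def by auto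
  then have *: "(f z - f x) < t * (f y - f x)" by (simp add: algebra_simps)
  then show "(f z - f x) / (z - x) < (f y - f x) / (y - x)"
    using assms by (simp add: t_def field_simps)
  have "(1 - t) * (f y - f x) < f y - f z" using * by (simp add: algebra_simps)
  moreover have "1 - t = (y - z) / (y - x)" using assms by (simp add: t_def field_simps)
  ultimately show "(f y - f x) / (y - x) < (f y - f z) / (y - z)"
    using assms by (simp add: field_simps)
qed

lemma marginal_less_slope:
  assumes "0 \<le> x" "x < y" "y \<le> 1"
  shows "c x < (f y - f x) / (y - x)"
proof -
  \<comment> \<open>A limit of secant slopes gives only a weak inequality. It is therefore taken
    against the secant to the midpoint \<open>m\<close>, and the strict increase of the slopes from
    \<open>m\<close> to \<open>y\<close> restores strictness.\<close>
  define m where "m = (x + y) / 2"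
  have m: "x < m" "m < y" using assms by (auto simp: m_def)
  have "(f has_real_derivative c x) (at x within {x<..<m})"
    by (rule has_field_derivative_subset[OF f_deriv]) (use assms m in auto)
  then have "((\<lambda>z. (f z - f x) / (z - x)) \<longlongrightarrow> c x) (at x within {x<..<m})"
    by (simp add: has_field_derivative_iff)
  moreover have "\<forall>\<^sub>F z in at x within {x<..<m}. (f z - f x) / (z - x) \<le> (f m - f x) / (m - x)"
    unfolding eventually_at_filter
    by (rule always_eventually) (use slopes(1)[of x _ m] assms m in \<open>auto intro: less_imp_le\<close>)
  moreover have "at x within {x<..<m} \<noteq> bot"
    using m by (simp add: trivial_limit_within islimpt_greaterThanLessThan1 islimpt_greaterThanLessThan2)
  ultimately have "c x \<le> (f m - f x) / (m - x)"
    by (rule tendsto_upperbound)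
  also have "\<dots> < (f y - f x) / (y - x)"
    using slopes(1)[of x m y] m assms by auto
  finally show ?thesis .
qed

lemma slope_less_marginal:
  assumes "0 \<le> x" "x < y" "y \<le> 1"
  shows "(f y - f x) / (y - x) < c y"
proof -
  define m where "m = (x + y) / 2"
  have m: "x < m" "m < y" using assms by (auto simp: m_def)
  have "(f has_real_derivative c y) (at y within {m<..<y})"
    by (rule has_field_derivative_subset[OF f_deriv]) (use assms m in auto)
  then have "((\<lambda>z. (f z - f y) / (z - y)) \<longlongrightarrow> c y) (at y within {m<..<y})"
    by (simp add: has_field_derivative_iff)
  moreover have "(f y - f m) / (y - m) \<le> (f z - f y) / (z - y)" if "z \<in> {m<..<y}" for z
    using slopes(2)[of m z y] that assms m minus_divide_divide[of "f y - f z" "y - z"] by auto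
  then have "\<forall>\<^sub>F z in at y within {m<..<y}. (f y - f m) / (y - m) \<le> (f z - f y) / (z - y)"
    unfolding eventually_at_filter by (intro always_eventually) auto
  moreover have "at y within {m<..<y} \<noteq> bot"
    using m by (simp add: trivial_limit_within islimpt_greaterThanLessThan1 islimpt_greaterThanLessThan2)
  ultimately have "(f y - f m) / (y - m) \<le> c y"
    by (intro tendsto_lowerbound)
  moreover have "(f y - f x) / (y - x) < (f y - f m) / (y - m)"
    using slopes(2)[of x m y] m assms by auto
  ultimately show ?thesis by simp
qed

lemma marginal_strict_mono: "0 \<le> x \<Longrightarrow> x < y \<Longrightarrow> y \<le> 1 \<Longrightarrow> c x < c y"
  using marginal_less_slope slope_less_marginal by (meson less_trans)

lemma marginal_mono: "0 \<le> x \<Longrightarrow> x \<le> y \<Longrightarrow> y \<le> 1 \<Longrightarrow> c x \<le> c y"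
  using marginal_strict_mono[of x y] by (cases "x = y") auto

lemma marginal_inj_on: "inj_on c {0..1}"
  by (rule linorder_inj_onI) (use marginal_strict_mono in force)+

lemma marginal_nonneg:
  assumes "x \<in> {0..1}" shows "0 \<le> c x"
proof (cases "x = 0")
  case False
  then have "0 \<le> (f x - f 0) / (x - 0)" using f_mono[of 0 x] assms by auto
  also have "\<dots> < c x" using slope_less_marginal[of 0 x] False assms by auto
  finally show ?thesis by simp
next
  case True
  have "(f has_real_derivative c 0) (at 0 within {0..1})" by (rule f_deriv) simp
  then have "((\<lambda>z. (f z - f 0) / (z - 0)) \<longlongrightarrow> c 0) (at 0 within {0..1})"
    by (simp add: has_field_derivative_iff)
  moreover have "\<forall>\<^sub>F z in at 0 within {0..1}. 0 \<le> (f z - f 0) / (z - 0)"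
    unfolding eventually_at_filter by (rule always_eventually) (use f_nonneg f_zero in auto)
  moreover have "at 0 within {0..1::real} \<noteq> bot"
    by (simp add: trivial_limit_within islimpt_greaterThanLessThan1 islimpt_greaterThanLessThan2)
  ultimately show ?thesis using True by (simp add: tendsto_lowerbound)
qed

lemma above_tangent:
  assumes "x \<in> {0..1}" "y \<in> {0..1}" "x \<noteq> y"
  shows "f x + c x * (y - x) < f y"
  using marginal_less_slope[of x y] slope_less_marginal[of y x] assms
  by (cases "x < y") (auto simp: field_simps)

text \<open>The derivative at \<open>x\<close> is squeezed between slopes of secants, which are continuous in \<open>x\<close>.\<close>

lemma marginal_continuous: "continuous_on {0..1} c"
proof -
  have fc: "(f \<longlongrightarrow> f x) (at x within {0..1})" if "x \<in> {0..1}" for x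
    using f_continuous that by (auto simp: continuous_on_def)
  show ?thesis
    unfolding continuous_on_def
  proof (intro ballI order_tendstoI)
    fix x u assume x: "x \<in> {0..1}" and u: "c x < u"
    show "\<forall>\<^sub>F z in at x within {0..1}. c z < u"
    proof (cases "x = 1")
      case True
      then show ?thesis unfolding eventually_at_filter
        by (intro always_eventually) (use u marginal_mono[of _ 1] in \<open>auto intro: le_less_trans\<close>)
    next
      case False
      have "((\<lambda>z. (f z - f x) / (z - x)) \<longlongrightarrow> c x) (at x within {x<..<1})"
        using has_field_derivative_subset[OF f_deriv[OF x], of "{x<..<1}"] x
        by (simp add: has_field_derivative_iff subset_iff)
      then have "\<forall>\<^sub>F z in at x within {x<..<1}. (f z - f x) / (z - x) < u"
        using u by (rule order_tendstoD)
      moreover have "\<forall>\<^sub>F z in at x within {x<..<1}. z \<in> {x<..<1}"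
        by (simp add: eventually_at_filter)
      moreover have "at x within {x<..<1} \<noteq> bot"
        using False x by (simp add: trivial_limit_within islimpt_greaterThanLessThan1 islimpt_greaterThanLessThan2)
      ultimately obtain y where y: "(f y - f x) / (y - x) < u" "x < y" "y < 1"
        using eventually_happens'[OF _ eventually_conj] by fastforce
      have "((\<lambda>z. (f y - f z) / (y - z)) \<longlongrightarrow> (f y - f x) / (y - x)) (at x within {0..1})"
        by (intro tendsto_intros fc x) (use y in auto)
      then have "\<forall>\<^sub>F z in at x within {0..1}. (f y - f z) / (y - z) < u"
        using y(1) by (rule order_tendstoD)
      moreover have "\<forall>\<^sub>F z in at x within {0..1}. z < y"
        using y by (intro order_tendstoD(2)[OF tendsto_ident_at]) auto
      moreover have "\<forall>\<^sub>F z in at x within {0..1}. z \<in> {0..1}"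
        by (simp add: eventually_at_filter)
      ultimately show ?thesis
        by eventually_elim (use marginal_less_slope[of _ y] y in force)
    qed
  next
    fix x u assume x: "x \<in> {0..1}" and u: "u < c x"
    show "\<forall>\<^sub>F z in at x within {0..1}. u < c z"
    proof (cases "x = 0")
      case True
      then show ?thesis unfolding eventually_at_filter
        by (intro always_eventually) (use u marginal_mono[of 0] in \<open>auto intro: less_le_trans\<close>)
    next
      case False
      have "((\<lambda>z. (f z - f x) / (z - x)) \<longlongrightarrow> c x) (at x within {0<..<x})"
        using has_field_derivative_subset[OF f_deriv[OF x], of "{0<..<x}"] x
        by (simp add: has_field_derivative_iff subset_iff)
      then have "\<forall>\<^sub>F z in at x within {0<..<x}. u < (f z - f x) / (z - x)"
        using u by (rule order_tendstoD)
      moreover have "\<forall>\<^sub>F z in at x within {0<..<x}. z \<in> {0<..<x}"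
        by (simp add: eventually_at_filter)
      moreover have "at x within {0<..<x} \<noteq> bot"
        using False x by (simp add: trivial_limit_within islimpt_greaterThanLessThan1 islimpt_greaterThanLessThan2)
      ultimately obtain y where y: "u < (f y - f x) / (y - x)" "0 < y" "y < x"
        using eventually_happens'[OF _ eventually_conj] by fastforce
      have "((\<lambda>z. (f y - f z) / (y - z)) \<longlongrightarrow> (f y - f x) / (y - x)) (at x within {0..1})"
        by (intro tendsto_intros fc x) (use y in auto)
      then have "\<forall>\<^sub>F z in at x within {0..1}. u < (f y - f z) / (y - z)"
        using y(1) by (rule order_tendstoD)
      moreover have "\<forall>\<^sub>F z in at x within {0..1}. y < z"
        using y by (intro order_tendstoD(1)[OF tendsto_ident_at]) auto
      moreover have "\<forall>\<^sub>F z in at x within {0..1}. z \<in> {0..1}"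
        by (simp add: eventually_at_filter)
      ultimately show ?thesis
      proof eventually_elim
        case (elim z)
        have "(f y - f z) / (y - z) = (f z - f y) / (z - y)"
          using minus_divide_divide[of "f z - f y" "z - y"] by simp
        then show ?case using slope_less_marginal[of y z] elim y by auto
      qed
    qed
  qed
qed

section \<open>Optimal load and maximal profit\<close>

lemma profit_less_optimum:
  assumes y: "y \<in> {0..1}" "c y = min p (c 1)" and z: "z \<in> {0..1}" "z \<noteq> y"
  shows "p * z - f z < p * y - f y"
proof -
  \<comment> \<open>The condition \<open>c y = min p (c 1)\<close> covers two cases: an interior
    optimum, where this is an equality, and a price above \<open>c 1\<close>, where the capacity
    binds, \<open>y = 1\<close>, and no feasible \<open>z\<close> exceeds \<open>y\<close>.\<close>
  have "p * (z - y) \<le> c y * (z - y)"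
  proof (cases "p \<le> c 1")
    case False
    then have "y = 1" using y inj_onD[OF marginal_inj_on, of y 1] by auto
    then show ?thesis using False z y by (intro mult_right_mono_neg) auto
  qed (use y in auto)
  then show ?thesis using above_tangent[of y z] y z by (auto simp: algebra_simps)
qed

lemma profit_alt: "profit f p y = (if y \<le> 1 then ereal (p * y - f y) else - \<infinity>)"
  by (simp add: profit_def ext_cost_def)

lemma opt_load_eqI:
  assumes y: "y \<in> {0..1}" "c y = min p (c 1)"
  shows "\<rho> p = y"
proof -
  have le: "profit f p z \<le> profit f p y" if "0 \<le> z" for z
    using profit_less_optimum[OF y, of z] y that by (cases "z = y") (auto simp: profit_alt)
  show ?thesis
    unfolding opt_load_def
  proof (rule arg_maxI[where x = y])
    fix x assume "0 \<le> x" "\<forall>z. 0 \<le> z \<longrightarrow> \<not> profit f p x < profit f p z"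
    then have "\<not> profit f p x < profit f p y" using y by auto
    then show "x = y"
      using profit_less_optimum[OF y, of x] y \<open>0 \<le> x\<close>
      by (cases "x = y") (auto simp: profit_alt split: if_splits)
  qed (use y le in \<open>auto simp: not_less\<close>)
qed

lemma max_profit_eqI:
  assumes y: "y \<in> {0..1}" "c y = min p (c 1)"
  shows "h p = p * y - f y"
proof -
  have le: "profit f p z \<le> profit f p y" if "0 \<le> z" for z
    using profit_less_optimum[OF y, of z] y that by (cases "z = y") (auto simp: profit_alt)
  have "(SUP z\<in>{0..}. profit f p z) = profit f p y"
    by (rule antisym, rule SUP_least) (use le y in \<open>auto intro!: SUP_upper\<close>)
  then show ?thesis using y by (simp add: max_profit_def profit_alt)
qed

lemma optimum_exists:
  assumes "c 0 \<le> p"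
  obtains y where "y \<in> {0..1}" "c y = min p (c 1)"
proof -
  have "\<exists>y. 0 \<le> y \<and> y \<le> 1 \<and> c y = min p (c 1)"
    by (rule IVT') (use assms marginal_continuous marginal_mono[of 0 1] in auto)
  then show thesis using that by auto
qed

lemma opt_load:
  assumes "c 0 \<le> p"
  shows opt_load_bounds: "0 \<le> \<rho> p" "\<rho> p \<le> 1"
    and marginal_opt_load: "c (\<rho> p) = min p (c 1)"
    and max_profit_eq: "h p = p * \<rho> p - f (\<rho> p)"
proof -
  obtain y where y: "y \<in> {0..1}" "c y = min p (c 1)" using optimum_exists[OF assms] .
  then have *: "\<rho> p = y" by (rule opt_load_eqI)
  show "0 \<le> \<rho> p" "\<rho> p \<le> 1" "c (\<rho> p) = min p (c 1)" using y * by auto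
  show "h p = p * \<rho> p - f (\<rho> p)" unfolding * by (rule max_profit_eqI[OF y])
qed

lemma profit_le_max_profit:
  assumes "c 0 \<le> p" "y \<in> {0..1}"
  shows "p * y - f y \<le> h p"
  using profit_less_optimum[of "\<rho> p" p y] opt_load[OF assms(1)] assms by (cases "y = \<rho> p") auto

lemma opt_load_pos:
  assumes "c 0 < p" shows "0 < \<rho> p"
  using opt_load[of p] assms marginal_strict_mono[of 0 1] by (cases "\<rho> p = 0") auto

text \<open>Keeping the load \<open>\<rho> p\<close> at the price \<open>q\<close> is feasible,
  which makes \<open>\<rho> p\<close> a subgradient of \<open>h\<close> at \<open>p\<close>.
  Exchanging \<open>p\<close> and \<open>q\<close> yields the matching upper bound.\<close>

lemma max_profit_diff_ge:
  assumes "c 0 \<le> p" "c 0 \<le> q"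
  shows "(q - p) * \<rho> p \<le> h q - h p"
  using profit_le_max_profit[OF assms(2), of "\<rho> p"] opt_load(1,2)[OF assms(1)]
    max_profit_eq[OF assms(1)] by (simp add: algebra_simps)

lemma opt_load_mono:
  assumes "c 0 \<le> p" "p \<le> q" shows "\<rho> p \<le> \<rho> q"
proof (rule ccontr)
  assume "\<not> \<rho> p \<le> \<rho> q"
  then have "c (\<rho> q) < c (\<rho> p)"
    using opt_load[of p] opt_load[of q] assms by (intro marginal_strict_mono) auto
  then show False using assms opt_load[of p] opt_load[of q] by auto
qed

text \<open>The load is the inverse of the marginal cost, which is continuous on a compact interval
  and injective, composed with the price capped at \<open>c 1\<close>.\<close>

lemma opt_load_continuous: "continuous_on {c 0..} \<rho>"
proof -
  define inv where "inv = the_inv_into {0..1} c"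
  have inv: "continuous_on (c ` {0..1}) inv"
    by (rule continuous_on_inv[OF marginal_continuous])
      (auto simp: inv_def the_inv_into_f_f[OF marginal_inj_on])
  have "min p (c 1) \<in> c ` {0..1}" if "c 0 \<le> p" for p
    using optimum_exists[OF that] by (metis image_eqI)
  then have "continuous_on {c 0..} (\<lambda>p. inv (min p (c 1)))"
    by (intro continuous_on_compose2[OF inv] continuous_intros) auto
  moreover have "inv (min p (c 1)) = \<rho> p" if "c 0 \<le> p" for p
    using opt_load[OF that] the_inv_into_f_f[OF marginal_inj_on, of "\<rho> p"] by (simp add: inv_def)
  ultimately show ?thesis by (rule continuous_on_eq) simp
qed

text \<open>Envelope theorem: the two subgradient inequalities squeeze the difference quotient
  between \<open>\<rho> p\<close> and \<open>\<rho> q\<close>, and continuity of the load closes the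
  gap. The marginal cost itself need not be differentiable.\<close>

lemma max_profit_deriv:
  assumes "c 0 < p"
  shows "(h has_real_derivative \<rho> p) (at p)"
proof -
  have "isCont \<rho> p"
    by (rule continuous_on_interior[OF opt_load_continuous]) (use assms in simp)
  then have "((\<lambda>q. \<rho> q - \<rho> p) \<longlongrightarrow> 0) (at p)"
    unfolding isCont_def by (rule LIM_zero)
  then have "((\<lambda>q. norm (\<rho> q - \<rho> p)) \<longlongrightarrow> 0) (at p)"
    by (rule tendsto_norm_zero)
  moreover have "\<forall>\<^sub>F q in at p. norm ((h q - h p) / (q - p) - \<rho> p) \<le> norm (\<rho> q - \<rho> p)"
  proof -
    have "\<forall>\<^sub>F q in at p. c 0 < q" using assms by (rule order_tendstoD[OF tendsto_ident_at])
    moreover have "\<forall>\<^sub>F q in at p. q \<noteq> p" by (simp add: eventually_at_filter)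
    ultimately show ?thesis
    proof eventually_elim
      case (elim q)
      have 1: "(q - p) * \<rho> p \<le> h q - h p" "h q - h p \<le> (q - p) * \<rho> q"
        using max_profit_diff_ge[of p q] max_profit_diff_ge[of q p] elim assms
        by (auto simp: algebra_simps)
      show ?case
      proof (cases "p < q")
        case True
        then have "\<rho> p \<le> (h q - h p) / (q - p)" "(h q - h p) / (q - p) \<le> \<rho> q"
          using 1 by (auto simp: field_simps)
        then show ?thesis by auto
      next
        case False
        then have "q < p" using elim by auto
        then have "(h q - h p) / (q - p) \<le> \<rho> p" "\<rho> q \<le> (h q - h p) / (q - p)"
          using 1 by (auto simp: field_simps)
        then show ?thesis by auto
      qed
    qed
  qed
  ultimately have "((\<lambda>q. (h q - h p) / (q - p) - \<rho> p) \<longlongrightarrow> 0) (at p)"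
    by (rule Lim_null_comparison[rotated])
  then show ?thesis unfolding has_field_derivative_iff by (rule LIM_zero_cancel)
qed

end

subsection \<open>The price equation\<close>

locale priced_cost = convex_cost +
  fixes p_lo :: real
  assumes p_lo: "marginal_cost f 0 < p_lo"
begin

lemma load_lo: "0 < \<rho> p_lo" "\<rho> p_lo \<le> 1"
  using opt_load_pos[OF p_lo] opt_load_bounds[of p_lo] p_lo by auto

text \<open>The subgradients of \<open>h\<close> increase with the price, so
  \<open>\<rho> p_lo > 0\<close> is a uniform lower bound for its slope. Its reciprocal becomes the
  Lipschitz constant of the inverse \<open>k\<close>.\<close>

lemma max_profit_growth:
  assumes "p_lo \<le> p" "p \<le> q"
  shows "(q - p) * \<rho> p_lo \<le> h q - h p"
proof -
  have "(q - p) * \<rho> p_lo \<le> (q - p) * \<rho> p"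
    using opt_load_mono[of p_lo p] p_lo assms by (intro mult_left_mono) auto
  also have "\<dots> \<le> h q - h p"
    using max_profit_diff_ge[of p q] p_lo assms by auto
  finally show ?thesis .
qed

lemma max_profit_strict_mono: "p_lo \<le> p \<Longrightarrow> p < q \<Longrightarrow> h p < h q"
  using max_profit_growth[of p q] load_lo mult_pos_pos[of "q - p" "\<rho> p_lo"] by linarith

lemma max_profit_mono: "p_lo \<le> p \<Longrightarrow> p \<le> q \<Longrightarrow> h p \<le> h q"
  using max_profit_strict_mono[of p q] by (cases "p = q") auto

lemma max_profit_lo_nonneg: "0 \<le> h p_lo"
  using profit_le_max_profit[of p_lo 0] p_lo f_zero by auto

text \<open>The inverse of \<open>h\<close> on \<open>{p_lo..}\<close>, extended to the left as a constant.\<close>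

definition k :: "real \<Rightarrow> real" where
  "k w = (THE p. p_lo \<le> p \<and> h p = max w (h p_lo))"

lemma k: "p_lo \<le> k w" "h (k w) = max w (h p_lo)"
proof -
  \<comment> \<open>A right end for the intermediate value theorem: growth at rate at least
    \<open>\<rho> p_lo\<close> carries \<open>h\<close> past the target level by the time the price
    is \<open>b\<close>.\<close>
  define b where "b = p_lo + (max w (h p_lo) - h p_lo) / \<rho> p_lo"
  have b: "p_lo \<le> b" using load_lo by (simp add: b_def)
  have "max w (h p_lo) = h p_lo + (b - p_lo) * \<rho> p_lo"
    using load_lo by (simp add: b_def)
  then have "max w (h p_lo) \<le> h b"
    using max_profit_growth[of p_lo b] b by auto
  moreover have "continuous_on {p_lo..b} h"
    using p_lo by (intro continuous_at_imp_continuous_on)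
      (auto intro!: DERIV_isCont[OF max_profit_deriv])
  ultimately have "\<exists>p. p_lo \<le> p \<and> p \<le> b \<and> h p = max w (h p_lo)"
    using b by (intro IVT') auto
  then obtain p where "p_lo \<le> p \<and> h p = max w (h p_lo)" by auto
  then have "\<exists>!p. p_lo \<le> p \<and> h p = max w (h p_lo)"
  proof (rule ex1I)
    fix q assume "p_lo \<le> q \<and> h q = max w (h p_lo)"
    with \<open>p_lo \<le> p \<and> _\<close> show "q = p"
      using max_profit_strict_mono[of p q] max_profit_strict_mono[of q p] by (cases p q rule: linorder_cases) auto
  qed
  from theI'[OF this] show "p_lo \<le> k w" "h (k w) = max w (h p_lo)"
    unfolding k_def by auto
qed

lemma k_mono: "w \<le> w' \<Longrightarrow> k w \<le> k w'"
  using k[of w] k[of w'] max_profit_strict_mono[of "k w'" "k w"] by linarith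

lemma k_strict_mono: "h p_lo \<le> w \<Longrightarrow> w < w' \<Longrightarrow> k w < k w'"
  using k[of w] k[of w'] max_profit_mono[of "k w'" "k w"] by linarith

lemma k_max_profit: "p_lo \<le> p \<Longrightarrow> k (h p) = p"
  using k[of "h p"] max_profit_mono[of p_lo p] max_profit_strict_mono[of p "k (h p)"]
    max_profit_strict_mono[of "k (h p)" p] by linarith

lemma k_eq_lo: "w \<le> h p_lo \<Longrightarrow> k w = p_lo"
  using k_mono[of w "h p_lo"] k(1)[of w] k_max_profit[of p_lo] by auto

lemma k_increment:
  assumes "w \<le> w'" shows "k w' - k w \<le> (w' - w) / \<rho> p_lo"
proof -
  have "(k w' - k w) * \<rho> p_lo \<le> h (k w') - h (k w)"
    by (rule max_profit_growth) (use k k_mono[OF assms] in auto)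
  also have "\<dots> \<le> w' - w" using assms by (auto simp: k)
  finally show ?thesis using load_lo by (simp add: field_simps)
qed

lemma k_lipschitz: "\<bar>k w - k w'\<bar> \<le> \<bar>w - w'\<bar> / \<rho> p_lo"
proof (cases "w \<le> w'")
  case True
  then show ?thesis using k_increment[of w w'] k_mono[of w w'] by (simp add: abs_if)
next
  case False
  then show ?thesis using k_increment[of w' w] k_mono[of w' w] by (simp add: abs_if)
qed

lemma k_continuous: "continuous_on S k"
proof -
  have "(1 / \<rho> p_lo)-lipschitz_on S k"
    using load_lo k_lipschitz by (intro lipschitz_onI) (auto simp: dist_real_def)
  then show ?thesis by (rule lipschitz_on_continuous_on)
qed

lemma k_deriv:
  assumes "h p_lo < w"
  shows "(k has_real_derivative 1 / \<rho> (k w)) (at w)"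
proof -
  have "c 0 < k w" using k(1)[of w] p_lo by linarith
  then have "(k has_real_derivative inverse (\<rho> (k w))) (at w)"
  proof (intro DERIV_inverse_function[where a = "h p_lo" and b = "w + 1"])
    show "isCont k w" using k_continuous[of UNIV] by (simp add: continuous_on_eq_continuous_at)
  qed (use assms opt_load_pos[of "k w"] max_profit_deriv k in auto)
  then show ?thesis by (simp add: inverse_eq_divide)
qed

text \<open>Neither extending \<open>k\<close> by a constant nor taking the positive part spoils the
  Lipschitz bound, and both keep the right-hand side defined for every \<open>w\<close>; hence a
  solution on all of \<open>{0..1}\<close> exists.\<close>

lemma welfare_ode:
  assumes "0 < \<alpha>"
  obtains W where "W 0 = 0"
    and "\<And>y. y \<in> {0..1} \<Longrightarrow>
      (W has_real_derivative \<alpha> * max 0 (k (W y) - c y)) (at y within {0..1})"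
proof (rule picard_lindelof_interval[of 0 1 "\<alpha> / \<rho> p_lo" "\<lambda>y w. \<alpha> * max 0 (k w - c y)" 0])
  show "0 < \<alpha> / \<rho> p_lo" using assms load_lo by simp
  have "continuous_on ({0..1} \<times> UNIV) (\<lambda>z. \<alpha> * max 0 (k (snd z) - c (fst z)))"
    by (intro continuous_intros continuous_on_compose2[OF k_continuous[of UNIV]]
        continuous_on_compose2[OF marginal_continuous]) auto
  then show "continuous_on ({0..1} \<times> UNIV) (\<lambda>(y, w). \<alpha> * max 0 (k w - c y))"
    by (simp add: case_prod_beta)
  fix y w w' :: real
  have "\<bar>\<alpha> * max 0 (k w - c y) - \<alpha> * max 0 (k w' - c y)\<bar>
      = \<alpha> * \<bar>max 0 (k w - c y) - max 0 (k w' - c y)\<bar>"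
    using assms by (simp add: right_diff_distrib[symmetric] abs_mult)
  also have "\<dots> \<le> \<alpha> * \<bar>k w - k w'\<bar>"
    using assms by (intro mult_left_mono) auto
  also have "\<dots> \<le> \<alpha> * (\<bar>w - w'\<bar> / \<rho> p_lo)"
    using assms k_lipschitz by (intro mult_left_mono) auto
  finally show "\<bar>\<alpha> * max 0 (k w - c y) - \<alpha> * max 0 (k w' - c y)\<bar> \<le> \<alpha> / \<rho> p_lo * \<bar>w - w'\<bar>"
    by simp
qed (use that in auto)

end

section \<open>The scaled welfare function \<open>W\<close> and its comparison properties\<close>

locale pricing_ode = priced_cost +
  fixes \<alpha> :: real and W :: "real \<Rightarrow> real"
  assumes \<alpha>: "1 \<le> \<alpha>"
    and W_zero: "W 0 = 0"
    and W_deriv: "\<And>y. y \<in> {0..1} \<Longrightarrow>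
      (W has_real_derivative \<alpha> * max 0 (k (W y) - marginal_cost f y)) (at y within {0..1})"
begin

lemma W_continuous: "continuous_on {0..1} W"
  using W_deriv DERIV_continuous by (fastforce simp: continuous_on_eq_continuous_within)

lemma W_DERIV: "0 < y \<Longrightarrow> y < 1 \<Longrightarrow> (W has_real_derivative \<alpha> * max 0 (k (W y) - c y)) (at y)"
  using W_deriv[of y] by (simp add: at_within_Icc_at)

lemma f_DERIV: "0 < y \<Longrightarrow> y < 1 \<Longrightarrow> (f has_real_derivative c y) (at y)"
  using f_deriv[of y] by (simp add: at_within_Icc_at)

lemma W_mono:
  assumes "0 \<le> x" "x \<le> y" "y \<le> 1"
  shows "W x \<le> W y"
proof (rule DERIV_nonneg_imp_increasing_open[OF assms(2)])
  show "\<exists>d. (W has_real_derivative d) (at t) \<and> 0 \<le> d" if "x < t" "t < y" for t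
    by (rule exI, rule conjI, rule W_DERIV) (use that assms \<alpha> in auto)
  show "continuous_on {x..y} W"
    by (rule continuous_on_subset[OF W_continuous]) (use assms in auto)
qed

text \<open>The price \<open>k (W t)\<close> does not fall after \<open>x\<close>, so
  \<open>W\<close> gains at least \<alpha> times what the fixed price \<open>k (W x)\<close> would
  earn. This is the benchmark for sales at a single density.\<close>

lemma W_increment_ge:
  assumes "0 \<le> x" "x \<le> y" "y \<le> 1"
  shows "\<alpha> * (k (W x) * (y - x) - (f y - f x)) \<le> W y - W x"
proof -
  define D where "D t = W t - \<alpha> * (k (W x) * t - f t)" for t
  have "D x \<le> D y"
  proof (rule DERIV_nonneg_imp_increasing_open[OF assms(2)])
    fix t assume t: "x < t" "t < y"
    have "(D has_real_derivative \<alpha> * max 0 (k (W t) - c t) - \<alpha> * (k (W x) - c t)) (at t)"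
      unfolding D_def[abs_def]
      by (rule derivative_eq_intros W_DERIV f_DERIV refl | use t assms in simp)+
    moreover have "k (W x) - c t \<le> max 0 (k (W t) - c t)"
      using k_mono[OF W_mono[of x t]] t assms by auto
    ultimately show "\<exists>d. (D has_real_derivative d) (at t) \<and> 0 \<le> d"
      using \<alpha> by (intro exI[of _ "\<alpha> * max 0 (k (W t) - c t) - \<alpha> * (k (W x) - c t)"]) auto
  next
    have "continuous_on {0..1} D"
      unfolding D_def[abs_def] by (intro continuous_intros W_continuous f_continuous)
    then show "continuous_on {x..y} D"
      by (rule continuous_on_subset) (use assms in auto)
  qed
  then show ?thesis by (simp add: D_def algebra_simps)
qed

text \<open>Once the price falls to the marginal cost the solution stalls: by the Lipschitz bound
  on \<open>k\<close>, its growth satisfies a linear homogeneous differential inequality.\<close>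

lemma W_stalls:
  assumes x: "0 \<le> x" "x \<le> y" "y \<le> 1" and le: "k (W x) \<le> c x"
  shows "W y = W x"
proof -
  define L where "L = \<alpha> / \<rho> p_lo"
  \<comment> \<open>The exponential is the integrating factor of
    \<open>W' \<le> L * (W - W x)\<close>. Since \<open>D x = 0\<close>, monotonicity of
    \<open>D\<close> leaves no room for \<open>W\<close> to rise.\<close>
  define D where "D t = (W x - W t) * exp (- L * t)" for t
  have "D x \<le> D y"
  proof (rule DERIV_nonneg_imp_increasing_open[OF x(2)])
    fix t assume t: "x < t" "t < y"
    let ?d = "(L * (W t - W x) - \<alpha> * max 0 (k (W t) - c t)) * exp (- L * t)"
    have "(D has_real_derivative ?d) (at t)"
      unfolding D_def[abs_def]
      by (rule derivative_eq_intros W_DERIV refl | use t x in \<open>simp add: algebra_simps\<close>)+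
    moreover have "max 0 (k (W t) - c t) \<le> (W t - W x) / \<rho> p_lo"
    proof -
      have "W x \<le> W t" using W_mono[of x t] t x by auto
      moreover have "c x \<le> c t" using marginal_mono[of x t] t x by auto
      ultimately show ?thesis using k_increment[of "W x" "W t"] le load_lo by auto
    qed
    then have "\<alpha> * max 0 (k (W t) - c t) \<le> \<alpha> * ((W t - W x) / \<rho> p_lo)"
      using \<alpha> by (intro mult_left_mono) auto
    then have "0 \<le> ?d" by (simp add: L_def)
    ultimately show "\<exists>d. (D has_real_derivative d) (at t) \<and> 0 \<le> d" by blast
  next
    have "continuous_on {0..1} D"
      unfolding D_def[abs_def] by (intro continuous_intros W_continuous)
    then show "continuous_on {x..y} D"
      by (rule continuous_on_subset) (use x in auto)
  qed
  then have "W y \<le> W x" by (simp add: D_def mult_le_0_iff zero_le_mult_iff)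
  then show ?thesis using W_mono[OF x] by simp
qed

text \<open>Discrete Gronwall argument for the positive part of the scaled welfare minus \<open>W\<close>.
  Competitiveness at one density bounds the next density, up to \<open>\<mu>\<close>, by \<open>k\<close> of the
  welfare accumulated so far.\<close>

lemma competitive_path_dominated:
  fixes U V q :: "nat \<Rightarrow> real"
  assumes zero: "U 0 = 0" "V 0 = 0"
    and U: "\<And>j. U j \<le> U (Suc j)" "\<And>j. j \<le> Suc N \<Longrightarrow> U j \<le> 1"
    and V: "\<And>j. V (Suc j) - V j = q j * (U (Suc j) - U j)"
    and comp: "\<And>j. j \<le> N \<Longrightarrow> h (q j) \<le> \<alpha> * (V (Suc j) - f (U (Suc j))) + \<eta>"
    and q: "q 0 = p_lo" "\<And>j. p_lo \<le> q j" "\<And>j. q (Suc j) \<le> q j + \<mu>"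
    and nonneg: "0 \<le> \<eta>" "0 \<le> \<mu>"
  shows "h (q N) \<le> W 1 + (\<eta> + \<mu> * \<rho> p_lo) * exp (\<alpha> / \<rho> p_lo)"
proof -
  define L where "L = \<alpha> / \<rho> p_lo"
  have L: "0 < L" using \<alpha> load_lo by (simp add: L_def)
  \<comment> \<open>After \<open>j\<close> stages \<open>E j\<close> is the quantity that
    competitiveness guarantees to be at least \<open>h\<close> of the previous density.\<close>
  define E where "E j = \<alpha> * (V j - f (U j)) + \<eta>" for j
  \<comment> \<open>The added constant absorbs the density step \<mu>: divided by
    \<open>\<rho> p_lo\<close> it is exactly \<mu>, so the recursion for \<open>M\<close> becomes
    homogeneous.\<close>
  define M where "M j = max 0 (E j - W (U j)) + \<mu> * \<rho> p_lo" for j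
  have U0: "0 \<le> U j" for j
    using lift_Suc_mono_le[of U 0 j] U(1) zero by simp
  have bound: "M j \<le> (\<eta> + \<mu> * \<rho> p_lo) * exp (L * U j)" if "j \<le> Suc N" for j
    using that
  proof (induction j)
    case 0
    then show ?case using nonneg by (simp add: M_def E_def zero f_zero W_zero)
  next
    case (Suc j)
    define \<Delta> where "\<Delta> = U (Suc j) - U j"
    have \<Delta>: "0 \<le> \<Delta>" using U(1)[of j] by (simp add: \<Delta>_def)
    have M: "0 \<le> M j" "\<mu> * \<rho> p_lo \<le> M j" using nonneg load_lo by (auto simp: M_def)
    \<comment> \<open>Stage 0 has no predecessor to appeal to, but its density is
      \<open>p_lo\<close>, the least value of \<open>k\<close>.\<close>
    have "q j \<le> k (E j) + \<mu>"
    proof (cases j)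
      case 0
      then show ?thesis using q(1) k(1)[of "E j"] nonneg by auto
    next
      case (Suc i)
      have "q i = k (h (q i))" using k_max_profit q by simp
      also have "\<dots> \<le> k (E j)"
        using comp[of i] Suc.prems Suc by (intro k_mono) (auto simp: E_def)
      finally show ?thesis using q(3)[of i] Suc by simp
    qed
    moreover have "k (E j) - k (W (U j)) \<le> max 0 (E j - W (U j)) / \<rho> p_lo"
      using k_increment[of "W (U j)" "E j"] k_mono[of "E j" "W (U j)"] load_lo
      by (cases "W (U j) \<le> E j") (auto simp: max_def)
    ultimately have "q j - k (W (U j)) \<le> max 0 (E j - W (U j)) / \<rho> p_lo + \<mu>" by linarith
    also have "\<dots> = M j / \<rho> p_lo" using load_lo by (simp add: M_def field_simps)
    finally have "\<alpha> * ((q j - k (W (U j))) * \<Delta>) \<le> \<alpha> * (M j / \<rho> p_lo * \<Delta>)"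
      using \<alpha> \<Delta> by (intro mult_left_mono mult_right_mono) auto
    then have 1: "\<alpha> * ((q j - k (W (U j))) * \<Delta>) \<le> L * M j * \<Delta>" by (simp add: L_def)
    have 2: "\<alpha> * (k (W (U j)) * \<Delta> - (f (U (Suc j)) - f (U j))) \<le> W (U (Suc j)) - W (U j)"
      using W_increment_ge[of "U j" "U (Suc j)"] U0 U Suc.prems by (simp add: \<Delta>_def)
    have "E (Suc j) - E j = \<alpha> * ((V (Suc j) - V j) - (f (U (Suc j)) - f (U j)))"
      by (simp add: E_def algebra_simps)
    also have "\<dots> = \<alpha> * ((q j - k (W (U j))) * \<Delta>)
        + \<alpha> * (k (W (U j)) * \<Delta> - (f (U (Suc j)) - f (U j)))"
      by (simp add: V \<Delta>_def algebra_simps)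
    also have "\<dots> \<le> L * M j * \<Delta> + (W (U (Suc j)) - W (U j))"
      using 1 2 by (rule add_mono)
    finally have "E (Suc j) - W (U (Suc j)) \<le> (E j - W (U j)) + L * M j * \<Delta>" by simp
    moreover have "0 \<le> L * M j * \<Delta>" using L M \<Delta> by simp
    ultimately have "M (Suc j) \<le> M j + L * M j * \<Delta>"
      unfolding M_def by linarith
    also have "\<dots> = M j * (1 + L * \<Delta>)" by (simp add: algebra_simps)
    \<comment> \<open>By \<open>1 + x \<le> exp x\<close> the load increments add up in the
      exponent, so the final bound depends on the total load, at most 1, and not on the number of
      stages.\<close>
    also have "\<dots> \<le> ((\<eta> + \<mu> * \<rho> p_lo) * exp (L * U j)) * exp (L * \<Delta>)"
      by (rule mult_mono) (use Suc M L \<Delta> nonneg load_lo exp_ge_add_one_self in auto)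
    also have "\<dots> = (\<eta> + \<mu> * \<rho> p_lo) * exp (L * U (Suc j))"
      by (simp add: exp_add[symmetric] \<Delta>_def algebra_simps)
    finally show ?case .
  qed
  have "h (q N) \<le> E (Suc N)" using comp[of N] by (simp add: E_def)
  also have "\<dots> \<le> W (U (Suc N)) + M (Suc N)"
    using nonneg load_lo mult_nonneg_nonneg[of \<mu> "\<rho> p_lo"] unfolding M_def by linarith
  also have "W (U (Suc N)) \<le> W 1" using W_mono U0 U by auto
  also have "M (Suc N) \<le> (\<eta> + \<mu> * \<rho> p_lo) * exp (L * U (Suc N))" using bound by simp
  also have "\<dots> \<le> (\<eta> + \<mu> * \<rho> p_lo) * exp L"
    by (intro mult_left_mono) (use L U[of "Suc N"] nonneg load_lo in auto)
  finally show ?thesis by (simp add: L_def)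
qed

text \<open>Because \<alpha> is at least 1, \<open>W\<close> has reached the level
  \<open>h p_lo\<close> by the load \<open>\<rho> p_lo\<close>, and the intermediate value theorem
  supplies \<omega>. The last equation makes the profit bound on \<omega> an equality.\<close>

lemma initial_load_exists:
  obtains \<omega> where "0 \<le> \<omega>" "\<omega> \<le> \<rho> p_lo" "W \<omega> = h p_lo" "\<alpha> * (p_lo * \<omega> - f \<omega>) = h p_lo"
proof -
  have "h p_lo \<le> \<alpha> * h p_lo"
    using \<alpha> max_profit_lo_nonneg mult_right_mono[of 1 \<alpha> "h p_lo"] by simp
  also have "\<dots> \<le> \<alpha> * (k (W 0) * (\<rho> p_lo - 0) - (f (\<rho> p_lo) - f 0))"
    using \<alpha> max_profit_eq[of p_lo] p_lo load_lo k(1)[of "W 0"] mult_right_mono[of p_lo "k (W 0)" "\<rho> p_lo"]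
    by (intro mult_left_mono) (auto simp: f_zero)
  also have "\<dots> \<le> W (\<rho> p_lo)"
    using W_increment_ge[of 0 "\<rho> p_lo"] load_lo by (simp add: W_zero)
  finally have "\<exists>\<omega>. 0 \<le> \<omega> \<and> \<omega> \<le> \<rho> p_lo \<and> W \<omega> = h p_lo"
    using load_lo max_profit_lo_nonneg W_zero
    by (intro IVT' continuous_on_subset[OF W_continuous]) auto
  then obtain \<omega> where \<omega>: "0 \<le> \<omega>" "\<omega> \<le> \<rho> p_lo" "W \<omega> = h p_lo" by auto
  have "\<alpha> * (p_lo * \<omega> - f \<omega>) = h p_lo"
  proof (cases "\<omega> = 0")
    case True
    then show ?thesis using \<omega> W_zero f_zero by auto
  next
    case False
    \<comment> \<open>Up to \<omega> the level \<open>h p_lo\<close> is not exceeded, so the price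
      stays at \<open>p_lo\<close>; the positive part is inactive because \<open>t\<close> lies
      below \<open>\<rho> p_lo\<close>. There \<open>W\<close> is simply \<alpha> times the profit
      at \<open>p_lo\<close>.\<close>
    define D where "D t = W t - \<alpha> * (p_lo * t - f t)" for t
    have "D \<omega> = D 0"
    proof (rule DERIV_isconst_end[of 0 \<omega> D])
      have "continuous_on {0..1} D"
        unfolding D_def[abs_def] by (intro continuous_intros W_continuous f_continuous)
      then show "continuous_on {0..\<omega>} D"
        by (rule continuous_on_subset) (use \<omega> load_lo in auto)
    next
      fix t assume t: "0 < t" "t < \<omega>"
      have t1: "t < 1" using t \<omega> load_lo by linarith
      have "k (W t) = p_lo" using W_mono[of t \<omega>] t \<omega> load_lo by (intro k_eq_lo) auto
      moreover have "c t \<le> p_lo"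
        using marginal_mono[of t "\<rho> p_lo"] marginal_opt_load[of p_lo] p_lo t \<omega> load_lo by auto
      moreover have "(D has_real_derivative \<alpha> * max 0 (k (W t) - c t) - \<alpha> * (p_lo - c t)) (at t)"
        unfolding D_def[abs_def]
        by (rule derivative_eq_intros W_DERIV f_DERIV refl | use t t1 in simp)+
      ultimately show "(D has_real_derivative 0) (at t)" by simp
    qed (use False \<omega> in auto)
    then show ?thesis using \<omega> by (simp add: D_def W_zero f_zero)
  qed
  then show thesis using \<omega> that by blast
qed

section \<open>Solutions of the boundary value problems\<close>

lemma bvp_solutions:
  assumes p_hi: "p_lo \<le> p_hi" and W_one: "h p_hi \<le> W 1"
    and \<omega>: "0 \<le> \<omega>" "\<omega> \<le> \<rho> p_lo" "W \<omega> = h p_lo"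
  obtains \<psi> \<phi> where
    "strict_mono_on {p_lo..p_hi} \<psi>" "solves_\<psi>_bvp f p_lo p_hi \<alpha> \<omega> \<psi>"
    "strict_mono_on {\<omega>..\<rho> p_hi} \<phi>" "solves_\<phi>_bvp f p_lo p_hi \<alpha> \<omega> \<phi>"
    "\<And>p. p \<in> {p_lo..p_hi} \<Longrightarrow> \<phi> (\<psi> p) = p"
proof -
  define r where "r = \<rho> p_hi"
  have c0: "c 0 \<le> p_hi" using p_lo p_hi by simp
  have r: "r \<le> 1" "c r = min p_hi (c 1)" "\<omega> \<le> r"
    using opt_load[OF c0] opt_load_mono[of p_lo p_hi] p_lo p_hi \<omega> by (auto simp: r_def)
  define \<phi> where "\<phi> y = k (W y)" for y
  have \<phi>_one: "p_hi \<le> \<phi> 1"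
    using k_mono[OF W_one] k_max_profit[OF p_hi] by (simp add: \<phi>_def)
  \<comment> \<open>If the price met the marginal cost before \<open>r\<close>, the solution would
    stall, and its final price would be at most \<open>c y < c r \<le> p_hi\<close>, contradicting
    \<open>\<phi>_one\<close>.\<close>
  have above: "c y < \<phi> y" if "\<omega> \<le> y" "y < r" for y
  proof (rule ccontr)
    assume "\<not> c y < \<phi> y"
    moreover from this have "\<phi> 1 = \<phi> y"
      using W_stalls[of y 1] that r \<omega> by (simp add: \<phi>_def)
    moreover have "c y < c r" using marginal_strict_mono[of y r] that r \<omega> by auto
    ultimately show False using \<phi>_one r by auto
  qed
  \<comment> \<open>When the capacity does not bind, \<open>c r = p_hi\<close>, so a price below
    \<open>p_hi\<close> at \<open>r\<close> would stall for good; otherwise \<open>r = 1\<close> and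
    \<open>\<phi>_one\<close> applies directly.\<close>
  have \<phi>_end: "p_hi \<le> \<phi> r"
  proof (rule ccontr)
    assume lt: "\<not> p_hi \<le> \<phi> r"
    show False
    proof (cases "p_hi \<le> c 1")
      case True
      then have "\<phi> 1 = \<phi> r"
        using W_stalls[of r 1] lt r \<omega> by (simp add: \<phi>_def)
      then show ?thesis using lt \<phi>_one by simp
    next
      case False
      then have "r = 1" using inj_onD[OF marginal_inj_on, of r 1] r \<omega> by auto
      then show ?thesis using lt \<phi>_one by simp
    qed
  qed
  have W_less: "W x < W y" if "\<omega> \<le> x" "x < y" "y \<le> r" for x y
  proof (rule DERIV_pos_imp_increasing_open[OF \<open>x < y\<close>])
    fix t assume t: "x < t" "t < y"
    have "0 < \<alpha> * max 0 (k (W t) - c t)"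
      using above[of t] \<alpha> t that by (auto simp: \<phi>_def intro!: mult_pos_pos)
    moreover have "(W has_real_derivative \<alpha> * max 0 (k (W t) - c t)) (at t)"
      by (rule W_DERIV) (use t that \<omega> r in auto)
    ultimately show "\<exists>d. (W has_real_derivative d) (at t) \<and> 0 < d" by blast
  next
    show "continuous_on {x..y} W"
      by (rule continuous_on_subset[OF W_continuous]) (use that \<omega> r in auto)
  qed
  have W_ge: "h p_lo \<le> W y" if "\<omega> \<le> y" "y \<le> r" for y
    using W_mono[of \<omega> y] that \<omega> r by auto
  have \<phi>_less: "\<phi> x < \<phi> y" if "\<omega> \<le> x" "x < y" "y \<le> r" for x y
    unfolding \<phi>_def using k_strict_mono[OF W_ge W_less[OF that]] that by auto
  then have \<phi>_strict: "strict_mono_on {\<omega>..r} \<phi>"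
    by (auto simp: strict_mono_on_def)
  then have \<phi>_inj: "inj_on \<phi> {\<omega>..r}"
    by (rule strict_mono_on_imp_inj_on)
  have \<phi>_cont: "continuous_on {\<omega>..r} \<phi>"
    unfolding \<phi>_def[abs_def]
    by (rule continuous_on_compose2[OF k_continuous[of UNIV]], rule continuous_on_subset[OF W_continuous])
      (use \<omega> r in auto)
  have \<phi>_start: "\<phi> \<omega> = p_lo" using k_max_profit[of p_lo] \<omega> by (simp add: \<phi>_def)
  have h_deriv: "deriv h (\<phi> y) = \<rho> (\<phi> y)" "0 < \<rho> (\<phi> y)" for y
  proof -
    have "c 0 < \<phi> y" using k(1)[of "W y"] p_lo by (simp add: \<phi>_def)
    then show "deriv h (\<phi> y) = \<rho> (\<phi> y)" "0 < \<rho> (\<phi> y)"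
      using opt_load_pos max_profit_deriv DERIV_imp_deriv by blast+
  qed
  have \<phi>_deriv: "(\<phi> has_real_derivative \<alpha> * ((\<phi> y - c y) / deriv h (\<phi> y))) (at y)"
    if y: "\<omega> < y" "y < r" for y
  proof -
    have "h p_lo < W y" using W_less[of \<omega> y] \<omega> y by simp
    then have "(\<phi> has_real_derivative 1 / \<rho> (\<phi> y) * (\<alpha> * max 0 (k (W y) - c y))) (at y)"
      unfolding \<phi>_def by (rule DERIV_chain2[OF k_deriv W_DERIV]) (use y \<omega> r in auto)
    moreover have "max 0 (k (W y) - c y) = \<phi> y - c y"
      using above[of y] y by (simp add: \<phi>_def)
    ultimately show ?thesis by (simp add: h_deriv mult.commute)
  qed
  have \<phi>_solves: "solves_\<phi>_bvp f p_lo p_hi \<alpha> \<omega> \<phi>"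
    unfolding solves_\<phi>_bvp_def r_def[symmetric]
    using \<phi>_cont \<phi>_deriv h_deriv \<phi>_start \<phi>_end by (auto simp: less_imp_neq[symmetric])
  \<comment> \<open>The end values of \<phi> make its range cover \<open>{p_lo..p_hi}\<close>, so
    inverting on \<open>{\<omega>..r}\<close> is legitimate there and places \<psi> below
    \<open>r\<close>, the required bound at \<open>p_hi\<close>.\<close>
  define \<psi> where "\<psi> = the_inv_into {\<omega>..r} \<phi>"
  have surj: "p \<in> \<phi> ` {\<omega>..r}" if "p \<in> {p_lo..p_hi}" for p
    using IVT'[of \<phi> \<omega> p r] \<phi>_cont \<phi>_start \<phi>_end r that by force
  have \<phi>\<psi>: "\<phi> (\<psi> p) = p" if "p \<in> {p_lo..p_hi}" for p
    unfolding \<psi>_def by (rule f_the_inv_into_f[OF \<phi>_inj surj[OF that]])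
  have \<psi>_in: "\<psi> p \<in> {\<omega>..r}" if "p \<in> {p_lo..p_hi}" for p
    unfolding \<psi>_def by (rule the_inv_into_into[OF \<phi>_inj surj[OF that]]) simp
  have \<psi>_less: "\<psi> p < \<psi> q" if "p \<in> {p_lo..p_hi}" "q \<in> {p_lo..p_hi}" "p < q" for p q
  proof (rule ccontr)
    assume "\<not> \<psi> p < \<psi> q"
    then have "\<phi> (\<psi> q) \<le> \<phi> (\<psi> p)"
      using \<phi>_less[of "\<psi> q" "\<psi> p"] \<psi>_in[of p] \<psi>_in[of q] that by (cases "\<psi> q = \<psi> p") auto
    then show False using \<phi>\<psi> that by auto
  qed
  have \<psi>_cont: "continuous_on {p_lo..p_hi} \<psi>"
  proof (rule continuous_on_subset)
    show "continuous_on (\<phi> ` {\<omega>..r}) \<psi>"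
      by (rule continuous_on_inv[OF \<phi>_cont]) (auto simp: \<psi>_def the_inv_into_f_f[OF \<phi>_inj])
  qed (use surj in auto)
  have \<psi>_start: "\<psi> p_lo = \<omega>"
    using the_inv_into_f_f[OF \<phi>_inj, of \<omega>] \<phi>_start r by (simp add: \<psi>_def)
  have "p - c (\<psi> p) \<noteq> 0 \<and> (\<psi> has_real_derivative 1 / \<alpha> * (deriv h p / (p - c (\<psi> p)))) (at p)"
    if p: "p \<in> {p_lo<..<p_hi}" for p
  proof -
    \<comment> \<open>Strict monotonicity keeps interior densities at interior loads, where the
      differential equation for \<phi> is available and its right-hand side is positive.\<close>
    have in_r: "\<omega> < \<psi> p" "\<psi> p < r"
      using \<psi>_less[of p_lo p] \<psi>_less[of p p_hi] \<psi>_in[of p_hi] \<psi>_start p by auto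
    have pp: "\<phi> (\<psi> p) = p" using \<phi>\<psi> p by auto
    have pos: "0 < p - c (\<psi> p)" using above[of "\<psi> p"] in_r pp by simp
    have h: "0 < deriv h p" using h_deriv[of "\<psi> p"] pp by simp
    have "(\<psi> has_real_derivative inverse (\<alpha> * ((\<phi> (\<psi> p) - c (\<psi> p)) / deriv h (\<phi> (\<psi> p))))) (at p)"
    proof (rule DERIV_inverse_function[where a = p_lo and b = p_hi])
      show "(\<phi> has_real_derivative \<alpha> * ((\<phi> (\<psi> p) - c (\<psi> p)) / deriv h (\<phi> (\<psi> p)))) (at (\<psi> p))"
        using \<phi>_deriv in_r by blast
      show "isCont \<psi> p"
        by (rule continuous_on_interior[OF \<psi>_cont]) (use p in auto)
    qed (use p \<phi>\<psi> pp pos h \<alpha> in auto)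
    then show ?thesis using pos pp by (simp add: inverse_eq_divide)
  qed
  then have \<psi>_solves: "solves_\<psi>_bvp f p_lo p_hi \<alpha> \<omega> \<psi>"
    unfolding solves_\<psi>_bvp_def r_def[symmetric]
    using \<psi>_cont \<psi>_start \<psi>_in[of p_hi] p_hi by auto
  have "strict_mono_on {p_lo..p_hi} \<psi>"
    using \<psi>_less by (auto simp: strict_mono_on_def)
  then show thesis
    using that \<psi>_solves \<phi>_strict \<phi>_solves \<phi>\<psi> by (simp add: r_def)
qed

end

subsection \<open>Staged arrival instances\<close>

text \<open>The \<open>i\<close>-th of \<open>n\<close> requests of size \<open>1 / m\<close> has density \<open>q (i div m)\<close>, so that
  each density in turn is offered often enough to fill the whole capacity.\<close>

definition staged :: "nat \<Rightarrow> (nat \<Rightarrow> real) \<Rightarrow> nat \<Rightarrow> agent list" where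
  "staged m q n = map (\<lambda>i. (1 / real m, q (i div m) / real m)) [0..<n]"

text \<open>The decision on request \<open>i\<close> sees only the first \<open>Suc i\<close>
  requests, so one set, independent of the total number of requests, records the run on all
  prefixes.\<close>

definition accepted_stages :: "algorithm \<Rightarrow> nat \<Rightarrow> (nat \<Rightarrow> real) \<Rightarrow> nat set" where
  "accepted_stages A m q = {i. A (staged m q (Suc i))}"

definition stage_load :: "algorithm \<Rightarrow> nat \<Rightarrow> (nat \<Rightarrow> real) \<Rightarrow> nat \<Rightarrow> real" where
  "stage_load A m q n = real (card (accepted_stages A m q \<inter> {..<n})) / real m"

definition stage_value :: "algorithm \<Rightarrow> nat \<Rightarrow> (nat \<Rightarrow> real) \<Rightarrow> nat \<Rightarrow> real" where
  "stage_value A m q n = (\<Sum>i\<in>accepted_stages A m q \<inter> {..<n}. q (i div m) / real m)"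

lemma length_staged [simp]: "length (staged m q n) = n"
  by (simp add: staged_def)

lemma nth_staged [simp]: "i < n \<Longrightarrow> staged m q n ! i = (1 / real m, q (i div m) / real m)"
  by (simp add: staged_def)

lemma fst_staged: "a \<in> set (staged m q n) \<Longrightarrow> fst a = 1 / real m"
  by (auto simp: staged_def)

lemma accepted_staged: "accepted A (staged m q n) = accepted_stages A m q \<inter> {..<n}"
proof -
  have "take (Suc i) (staged m q n) = staged m q (Suc i)" if "i < n" for i
    using that by (simp add: staged_def take_map del: upt_Suc)
  then show ?thesis by (auto simp: accepted_def accepted_stages_def)
qed

lemma utilization_staged:
  assumes "X \<subseteq> {..<n}" shows "utilization (staged m q n) X = real (card X) / real m"
proof -
  have "utilization (staged m q n) X = (\<Sum>i\<in>X. 1 / real m)"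
    unfolding utilization_def by (rule sum.cong) (use assms in auto)
  then show ?thesis by simp
qed

lemma welfare_staged:
  assumes "X \<subseteq> {..<n}"
  shows "welfare f (staged m q n) X =
    (\<Sum>i\<in>X. q (i div m) / real m) - f (real (card X) / real m)"
proof -
  have "(\<Sum>i\<in>X. snd (staged m q n ! i)) = (\<Sum>i\<in>X. q (i div m) / real m)"
    by (rule sum.cong) (use assms in auto)
  then show ?thesis by (simp add: welfare_def utilization_staged[OF assms])
qed

lemma utilization_accepted_staged:
  "utilization (staged m q n) (accepted A (staged m q n)) = stage_load A m q n"
  by (simp add: accepted_staged utilization_staged stage_load_def)

lemma S_online_staged:
  "S_online f A (staged m q n) = stage_value A m q n - f (stage_load A m q n)"
  by (simp add: S_online_def accepted_staged welfare_staged stage_value_def stage_load_def)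

lemma arrival_instance_staged:
  assumes "0 < m" "\<And>j. p_lo \<le> q j" "\<And>j. q j \<le> p_hi"
  shows "arrival_instance p_lo p_hi (staged m q n)"
  using assms by (auto simp: arrival_instance_def staged_def density_def)

lemma stage_load_zero: "stage_load A m q 0 = 0" "stage_value A m q 0 = 0"
  by (simp_all add: stage_load_def stage_value_def)

lemma stage_load_mono: "n \<le> n' \<Longrightarrow> stage_load A m q n \<le> stage_load A m q n'"
  unfolding stage_load_def by (intro divide_right_mono of_nat_mono card_mono) auto

lemma stage_load_Suc: "stage_load A m q (Suc n) \<le> stage_load A m q n + 1 / real m"
proof -
  let ?X = "accepted_stages A m q"
  have "card (?X \<inter> {..<Suc n}) \<le> card (insert n (?X \<inter> {..<n}))"
    by (rule card_mono) auto
  then have "real (card (?X \<inter> {..<Suc n})) \<le> real (card (?X \<inter> {..<n})) + 1" by simp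
  then have "real (card (?X \<inter> {..<Suc n})) / real m \<le> (real (card (?X \<inter> {..<n})) + 1) / real m"
    by (rule divide_right_mono) simp
  then show ?thesis by (simp add: stage_load_def add_divide_distrib)
qed

lemma stage_value_increment:
  assumes "0 < m"
  shows "stage_value A m q (m * Suc j) - stage_value A m q (m * j)
    = q j * (stage_load A m q (m * Suc j) - stage_load A m q (m * j))"
proof -
  let ?X = "accepted_stages A m q \<inter> {..<m * j}"
  let ?Y = "accepted_stages A m q \<inter> {m * j..<m * Suc j}"
  have split: "accepted_stages A m q \<inter> {..<m * Suc j} = ?X \<union> ?Y" by auto
  have div: "i div m = j" if "i \<in> ?Y" for i
    using that assms by (intro div_nat_eqI) (auto simp: algebra_simps)
  have "(\<Sum>i\<in>?Y. q (i div m) / real m) = (\<Sum>i\<in>?Y. q j / real m)"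
    by (rule sum.cong) (use div in auto)
  then have "stage_value A m q (m * Suc j) - stage_value A m q (m * j) = q j * (real (card ?Y) / real m)"
    unfolding stage_value_def split by (subst sum.union_disjoint) auto
  moreover have "stage_load A m q (m * Suc j) - stage_load A m q (m * j) = real (card ?Y) / real m"
    unfolding stage_load_def split by (subst card_Un_disjoint) (auto simp: add_divide_distrib)
  ultimately show ?thesis by simp
qed

lemma stage_load_le_one:
  assumes "online_algorithm p_lo p_hi A" "0 < m" "\<And>j. p_lo \<le> q j" "\<And>j. q j \<le> p_hi"
  shows "stage_load A m q n \<le> 1"
  using assms(1) arrival_instance_staged[of m p_lo q p_hi n, OF assms(2-4)]
  unfolding online_algorithm_def utilization_accepted_staged[symmetric] by blast

lemma stage_value_le:
  assumes "\<And>j. q j \<le> p"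
  shows "stage_value A m q n \<le> p * stage_load A m q n"
proof -
  have "stage_value A m q n \<le> (\<Sum>i\<in>accepted_stages A m q \<inter> {..<n}. p / real m)"
    unfolding stage_value_def by (intro sum_mono divide_right_mono assms) auto
  then show ?thesis by (simp add: stage_load_def mult.commute)
qed

section \<open>Competitiveness on staged instances\<close>

context convex_cost
begin

text \<open>A feasible offline choice takes requests of stage \<open>j\<close> only, as many as fit
  into the optimal load. Rounding that load down loses less than one request, worth
  \<open>q j / m\<close>, and does not raise the cost.\<close>

lemma S_offline_staged:
  assumes m: "0 < m" and q: "c 0 \<le> q j"
  shows "h (q j) - q j / real m \<le> S_offline f (staged m q (m * Suc j))"
proof -
  have q0: "0 \<le> q j" using marginal_nonneg[of 0] q by simp
  define l where "l = nat \<lfloor>\<rho> (q j) * real m\<rfloor>"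
  have \<rho>: "0 \<le> \<rho> (q j)" "\<rho> (q j) \<le> 1" using opt_load[OF q] by auto
  have l: "real l \<le> \<rho> (q j) * real m" "\<rho> (q j) * real m < real l + 1"
    using \<rho> by (auto simp: l_def)
  have "\<rho> (q j) * real m \<le> 1 * real m" using \<rho> by (intro mult_right_mono) auto
  then have lm: "l \<le> m" using l by linarith
  define X where "X = {m * j..<m * j + l}"
  have X: "X \<subseteq> {..<m * Suc j}" "card X = l" using lm by (auto simp: X_def)
  have "i div m = j" if "i \<in> X" for i
    using that m lm by (intro div_nat_eqI) (auto simp: X_def algebra_simps)
  then have "(\<Sum>i\<in>X. q (i div m) / real m) = (\<Sum>i\<in>X. q j / real m)"
    by (intro sum.cong) auto
  then have W: "welfare f (staged m q (m * Suc j)) X = q j * (real l / real m) - f (real l / real m)"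
    unfolding welfare_staged[OF X(1)] using X by simp
  have "(\<rho> (q j) * real m - 1) / real m \<le> real l / real m"
    using l by (intro divide_right_mono) auto
  then have lm': "real l / real m \<le> \<rho> (q j)" "\<rho> (q j) - 1 / real m \<le> real l / real m"
    using l m by (auto simp: pos_divide_le_eq diff_divide_distrib)
  have "h (q j) - q j / real m = q j * (\<rho> (q j) - 1 / real m) - f (\<rho> (q j))"
    using opt_load[OF q] by (simp add: algebra_simps)
  also have "\<dots> \<le> q j * (real l / real m) - f (real l / real m)"
    using f_mono[OF _ lm'(1)] \<rho> lm'(2) q0
    by (intro diff_mono mult_left_mono) auto
  also have "\<dots> \<le> S_offline f (staged m q (m * Suc j))"
    unfolding S_offline_def W[symmetric]
  proof (rule Max_ge)
    have "utilization (staged m q (m * Suc j)) X \<le> 1"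
      using utilization_staged[OF X(1)] X lm m by simp
    then show "welfare f (staged m q (m * Suc j)) X \<in> welfare f (staged m q (m * Suc j)) `
        {X. X \<subseteq> {..<length (staged m q (m * Suc j))} \<and> utilization (staged m q (m * Suc j)) X \<le> 1}"
      using X by auto
  qed simp
  finally show ?thesis .
qed

lemma competitive_stages:
  assumes A: "online_algorithm p_lo p_hi A" "competitive f p_lo p_hi \<alpha> A"
    and p: "c 0 < p_lo" "p_lo \<le> p_hi" and \<alpha>: "0 \<le> \<alpha>" and \<eta>: "0 < \<eta>"
  obtains m :: nat where "0 < m" "1 / real m \<le> \<eta>"
    and "\<And>q j. \<lbrakk>\<And>j. p_lo \<le> q j; \<And>j. q j \<le> p_hi\<rbrakk> \<Longrightarrow>
      h (q j) \<le> \<alpha> * (stage_value A m q (m * Suc j) - f (stage_load A m q (m * Suc j))) + \<eta>"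
proof -
  have p_hi: "0 < p_hi" using p marginal_nonneg[of 0] by simp
  \<comment> \<open>Online welfare is at most \<open>p_hi\<close>, so the slack in the competitive
    ratio costs at most half of \<eta>; the other half pays for the rounding of the offline
    load.\<close>
  define \<delta> where "\<delta> = \<eta> / (2 * p_hi)"
  have \<delta>: "0 < \<delta>" using p_hi \<eta> by (simp add: \<delta>_def)
  then obtain \<epsilon> where \<epsilon>: "0 < \<epsilon>"
    "\<And>as. arrival_instance p_lo p_hi as \<Longrightarrow> \<forall>a\<in>set as. fst a \<le> \<epsilon> \<Longrightarrow>
      S_offline f as \<le> (\<alpha> + \<delta>) * S_online f A as"
    using A(2) unfolding competitive_def by meson
  have "0 < min (min \<epsilon> \<eta>) \<delta>" using \<epsilon> \<eta> \<delta> by simp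
  then obtain n :: nat where n: "1 / real (Suc n) < min (min \<epsilon> \<eta>) \<delta>"
    by (rule nat_approx_posE)
  define m where "m = Suc n"
  have m: "0 < m" "1 / real m < min (min \<epsilon> \<eta>) \<delta>" using n by (simp_all add: m_def)
  show thesis
  proof (rule that[OF m(1)])
    show "1 / real m \<le> \<eta>" using m by simp
    fix q :: "nat \<Rightarrow> real" and j
    assume q: "\<And>j. p_lo \<le> q j" "\<And>j. q j \<le> p_hi"
    let ?n = "m * Suc j"
    let ?S = "stage_value A m q ?n - f (stage_load A m q ?n)"
    have load: "0 \<le> stage_load A m q ?n" "stage_load A m q ?n \<le> 1"
      using stage_load_mono[of 0 ?n A m q] stage_load_zero stage_load_le_one[OF A(1) m(1) q] by auto
    have "stage_value A m q ?n \<le> p_hi * stage_load A m q ?n"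
      by (rule stage_value_le) (rule q)
    also have "\<dots> \<le> p_hi * 1" using load p_hi by (intro mult_left_mono) auto
    finally have S: "?S \<le> p_hi" using f_nonneg[OF load] by simp
    have "q j / real m \<le> p_hi * (1 / real m)"
      using q(2)[of j] by (simp add: divide_right_mono)
    also have "\<dots> \<le> p_hi * \<delta>" using m p_hi by (intro mult_left_mono) auto
    finally have "q j / real m \<le> \<eta> / 2" using p_hi by (simp add: \<delta>_def)
    moreover have "h (q j) - q j / real m \<le> S_offline f (staged m q ?n)"
      using S_offline_staged[of m q j] m p q(1)[of j] by auto
    moreover have "S_offline f (staged m q ?n) \<le> (\<alpha> + \<delta>) * S_online f A (staged m q ?n)"
      using m by (intro \<epsilon>(2) arrival_instance_staged q) (auto simp: fst_staged)
    moreover have "\<delta> * ?S \<le> \<eta> / 2"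
      using mult_left_mono[OF S, of \<delta>] \<delta> p_hi by (simp add: \<delta>_def)
    ultimately show "h (q j) \<le> \<alpha> * ?S + \<eta>"
      unfolding S_online_staged distrib_right by linarith
  qed
qed

lemma profit_strict_mono:
  assumes p: "c 0 \<le> p" and xy: "0 \<le> x" "x < y" "y \<le> \<rho> p"
  shows "p * x - f x < p * y - f y"
proof -
  have y: "y \<le> 1" "c y \<le> p"
    using opt_load[OF p] marginal_mono[of y "\<rho> p"] xy by auto
  have "f y - f x < c y * (y - x)"
    using slope_less_marginal[of x y] xy y by (simp add: field_simps)
  also have "\<dots> \<le> p * (y - x)" using y xy by (intro mult_right_mono) auto
  finally show ?thesis by (simp add: algebra_simps)
qed

end

section \<open>Consequences of competitiveness for \<open>W\<close> and \<omega>\<close>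

context pricing_ode
begin

lemma W_one_ge:
  assumes A: "online_algorithm p_lo p_hi A" "competitive f p_lo p_hi \<alpha> A" and p: "p_lo \<le> p_hi"
  shows "h p_hi \<le> W 1"
proof (rule field_le_epsilon)
  fix e :: real assume e: "0 < e"
  define K where "K = exp (\<alpha> / \<rho> p_lo)"
  have K: "0 < K" by (simp add: K_def)
  \<comment> \<open>The two errors, from competitiveness and from the density steps, each contribute
    half of \<open>e\<close> after multiplication by the Gronwall factor \<open>K\<close>.\<close>
  define \<eta> where "\<eta> = e / (2 * K)"
  define \<mu> where "\<mu> = e / (2 * K * \<rho> p_lo)"
  have pos: "0 < \<eta>" "0 < \<mu>" using e K load_lo by (auto simp: \<eta>_def \<mu>_def)
  obtain m :: nat where m: "0 < m" "1 / real m \<le> \<eta>" and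
    comp: "\<And>q j. \<lbrakk>\<And>j. p_lo \<le> q j; \<And>j. q j \<le> p_hi\<rbrakk> \<Longrightarrow>
      h (q j) \<le> \<alpha> * (stage_value A m q (m * Suc j) - f (stage_load A m q (m * Suc j))) + \<eta>"
    using competitive_stages[OF A p_lo p order.trans[OF zero_le_one \<alpha>] pos(1)] by blast
  obtain N :: nat where N: "p_hi - p_lo < real N * \<mu>"
    using reals_Archimedean3[OF pos(2)] by blast
  define q where "q j = min p_hi (p_lo + real j * \<mu>)" for j
  have q: "p_lo \<le> q j" "q j \<le> p_hi" for j using p pos by (auto simp: q_def)
  have "h (q N) \<le> W 1 + (\<eta> + \<mu> * \<rho> p_lo) * exp (\<alpha> / \<rho> p_lo)"
  proof (rule competitive_path_dominated)
    show "h (q j) \<le> \<alpha> * (stage_value A m q (m * Suc j) - f (stage_load A m q (m * Suc j))) + \<eta>" for j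
      using comp q by blast
    show "q (Suc j) \<le> q j + \<mu>" for j using pos by (auto simp: q_def algebra_simps)
    show "stage_load A m q (m * j) \<le> stage_load A m q (m * Suc j)" for j
      by (rule stage_load_mono) simp
    show "stage_load A m q (m * j) \<le> 1" for j
      by (rule stage_load_le_one[OF A(1) m(1)]) (use q in auto)
  qed (use p pos q m stage_load_zero stage_value_increment in \<open>auto simp: q_def\<close>)
  moreover have "q N = p_hi" using N by (simp add: q_def)
  moreover have "(\<eta> + \<mu> * \<rho> p_lo) * K = e"
    using K load_lo by (simp add: \<eta>_def \<mu>_def field_simps)
  ultimately show "h p_hi \<le> W 1 + e" by (simp add: K_def)
qed

text \<open>When only density \<open>p_lo\<close> is offered, competitiveness forces the load beyond
  \<open>\<omega> - \<eta>\<close> within one stage. Cutting the instance at the first request that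
  achieves this overshoots by at most one request.\<close>

lemma initial_load_reached:
  assumes A: "online_algorithm p_lo p_hi A" "competitive f p_lo p_hi \<alpha> A" and p: "p_lo \<le> p_hi"
    and \<omega>: "0 \<le> \<omega>" "\<omega> \<le> \<rho> p_lo" "\<alpha> * (p_lo * \<omega> - f \<omega>) \<le> h p_lo"
  shows "reaches_utilization p_lo p_hi A p_lo \<omega>"
  unfolding reaches_utilization_def
proof (intro allI impI)
  fix \<eta> :: real assume \<eta>: "0 < \<eta>"
  let ?goal = "\<lambda>as. arrival_instance p_lo p_hi as \<and> (\<forall>a\<in>set as. fst a \<le> \<eta>) \<and>
    (\<forall>n\<in>accepted A as. density (as ! n) = p_lo) \<and> \<bar>utilization as (accepted A as) - \<omega>\<bar> \<le> \<eta>"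
  show "\<exists>as. ?goal as"
  proof (cases "\<omega> \<le> \<eta>")
    case True
    then have "?goal []"
      using \<omega> \<eta> by (simp add: arrival_instance_def utilization_def accepted_def)
    then show ?thesis ..
  next
    case False
    define x where "x = \<omega> - \<eta>"
    \<comment> \<open>The scaled profit lost by stopping at \<open>x\<close>. A competitive error of
      half this gap cannot hide the loss, which rules out a load of at most
      \<open>x\<close>.\<close>
    define gap where "gap = \<alpha> * ((p_lo * \<omega> - f \<omega>) - (p_lo * x - f x))"
    have x: "0 \<le> x" "x < \<omega>" "x \<le> \<rho> p_lo" using False \<eta> \<omega> by (auto simp: x_def)
    have "0 < gap"
      using profit_strict_mono[of p_lo x \<omega>] x \<omega> p_lo \<alpha> by (auto simp: gap_def)
    then have tol: "0 < min (gap / 2) \<eta>" using \<eta> by simp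
    obtain m :: nat where m: "0 < m" "1 / real m \<le> min (gap / 2) \<eta>" and
      comp: "\<And>q j. \<lbrakk>\<And>j. p_lo \<le> q j; \<And>j. q j \<le> p_hi\<rbrakk> \<Longrightarrow>
        h (q j) \<le> \<alpha> * (stage_value A m q (m * Suc j) - f (stage_load A m q (m * Suc j)))
          + min (gap / 2) \<eta>"
      using competitive_stages[OF A p_lo p order.trans[OF zero_le_one \<alpha>] tol] by blast
    define q where "q j = p_lo" for j :: nat
    define u where "u = stage_load A m q"
    have q: "p_lo \<le> q j" "q j \<le> p_hi" for j using p by (auto simp: q_def)
    have u0: "u 0 = 0" "0 \<le> u m"
      using stage_load_zero[of A m q] stage_load_mono[of 0 m A m q] by (auto simp: u_def)
    have "h p_lo \<le> \<alpha> * (stage_value A m q m - f (u m)) + gap / 2"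
      using comp[of q 0] q by (auto simp: u_def q_def)
    also have "stage_value A m q m = p_lo * u m"
      using stage_value_increment[OF m(1), of A q 0] stage_load_zero[of A m q] by (simp add: u_def q_def)
    finally have "h p_lo \<le> \<alpha> * (p_lo * u m - f (u m)) + gap / 2" .
    moreover have "gap = \<alpha> * (p_lo * \<omega> - f \<omega>) - \<alpha> * (p_lo * x - f x)"
      unfolding gap_def by (rule right_diff_distrib)
    moreover have "z < y" if "a \<le> y + g / 2" "g = b - z" "b \<le> a" "0 < g" for a b g y z :: real
      using that by (simp add: field_simps)
    ultimately have "\<alpha> * (p_lo * x - f x) < \<alpha> * (p_lo * u m - f (u m))"
      using \<omega>(3) \<open>0 < gap\<close> by blast
    then have "p_lo * x - f x < p_lo * u m - f (u m)" using \<alpha> by simp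
    then have "x < u m"
      using profit_strict_mono[of p_lo "u m" x] x u0 p_lo by (cases "u m = x") force+
    define n where "n = (LEAST n. x < u n)"
    have n: "x < u n" unfolding n_def using \<open>x < u m\<close> by (rule LeastI)
    have "n \<noteq> 0" using n u0 x by (cases n) auto
    then obtain n' where n': "n = Suc n'" by (cases n) auto
    then have "\<not> x < u n'" using not_less_Least[of n' "\<lambda>n. x < u n"] by (simp add: n_def)
    then have "u n \<le> \<omega>"
      using stage_load_Suc[of A m q n'] m by (simp add: n' u_def x_def)
    then have "\<bar>u n - \<omega>\<bar> \<le> \<eta>" using n \<eta> by (simp add: x_def)
    moreover have "density (staged m q n ! i) = p_lo" if "i \<in> accepted A (staged m q n)" for i
      using that m by (auto simp: accepted_staged density_def q_def)
    ultimately have "?goal (staged m q n)"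
      using arrival_instance_staged[OF m(1), of p_lo q p_hi n] q m fst_staged
      by (auto simp: utilization_accepted_staged u_def)
    then show ?thesis ..
  qed
qed

end

theorem theorem2:
  fixes f :: "real \<Rightarrow> real" and p_lo p_hi \<alpha> :: real and A :: algorithm
  assumes "convex_setup f p_lo p_hi"
    and "\<alpha> \<ge> 1"
    and "online_algorithm p_lo p_hi A"
    and "competitive f p_lo p_hi \<alpha> A"
  shows "\<exists>\<omega>. profit f p_lo \<omega> \<ge> ereal (1 / \<alpha> * max_profit f p_lo) \<and>
           0 \<le> \<omega> \<and> \<omega> \<le> opt_load f p_lo \<and>
           reaches_utilization p_lo p_hi A p_lo \<omega> \<and>
           (\<exists>\<psi> \<phi>.
              strict_mono_on {p_lo..p_hi} \<psi> \<and>
              solves_\<psi>_bvp f p_lo p_hi \<alpha> \<omega> \<psi> \<and>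
              strict_mono_on {\<omega>..opt_load f p_hi} \<phi> \<and>
              solves_\<phi>_bvp f p_lo p_hi \<alpha> \<omega> \<phi> \<and>
              (\<forall>p\<in>{p_lo..p_hi}. \<phi> (\<psi> p) = p))"
proof -
  interpret priced_cost f p_lo
    using assms(1) by unfold_locales (auto simp: convex_setup_def)
  have p: "p_lo \<le> p_hi" using assms(1) by (simp add: convex_setup_def)
  obtain W where "W 0 = 0" "\<And>y. y \<in> {0..1} \<Longrightarrow>
      (W has_real_derivative \<alpha> * max 0 (k (W y) - c y)) (at y within {0..1})"
    using welfare_ode[of \<alpha>] assms(2) by auto
  then interpret pricing_ode f p_lo \<alpha> W
    using assms(2) by unfold_locales auto
  \<comment> \<open>Up to here the algorithm has not entered: \<open>W\<close> and \<omega> come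
    from \<open>f\<close>, \<open>p_lo\<close> and \<alpha> alone. Competitiveness is used for
    \<open>W_one_ge\<close> and for reaching \<omega>.\<close>
  obtain \<omega> where \<omega>: "0 \<le> \<omega>" "\<omega> \<le> \<rho> p_lo" "W \<omega> = h p_lo" "\<alpha> * (p_lo * \<omega> - f \<omega>) = h p_lo"
    by (rule initial_load_exists)
  obtain \<psi> \<phi> where
    "strict_mono_on {p_lo..p_hi} \<psi>" "solves_\<psi>_bvp f p_lo p_hi \<alpha> \<omega> \<psi>"
    "strict_mono_on {\<omega>..\<rho> p_hi} \<phi>" "solves_\<phi>_bvp f p_lo p_hi \<alpha> \<omega> \<phi>"
    "\<And>p. p \<in> {p_lo..p_hi} \<Longrightarrow> \<phi> (\<psi> p) = p"
    using bvp_solutions[OF p W_one_ge[OF assms(3,4) p] \<omega>(1-3)] by blast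
  moreover have "ereal (1 / \<alpha> * h p_lo) \<le> profit f p_lo \<omega>"
    using \<omega> load_lo assms(2) unfolding \<omega>(4)[symmetric] by (simp add: profit_alt)
  moreover have "reaches_utilization p_lo p_hi A p_lo \<omega>"
    using initial_load_reached[OF assms(3,4) p \<omega>(1,2)] \<omega>(4) by simp
  ultimately show ?thesis using \<omega> by blast
qed

end
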